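(* Let $\mathcal{D}$ be a model category and $X\colon\Delta^{\mathrm{op}}\to\mathcal{D}$ a simplicial object. Then $X$ is upper $2$-Segal if and only if it is right $2$-Segal, and $X$ is lower $2$-Segal if and only if it is left $2$-Segal.
   Context: For a subset $I\subseteq[n]=\{0<1<\dots<n\}$ write $X_I\cong X_{|I|-1}$ for the value of $X$ on the ordered set $I$; inclusions of subsets induce restriction maps. $d_i$ denotes the $i$-th face map (omitting vertex $i$), and $\times^h$ the homotopy pullback. $X$ is left $2$-Segal if for every $n\ge3$ and $0\le j\le n$ the map $X_n\to X_{\{0,j,j+1,\dots,n\}}\times^h_{X_{\{0,j\}}}X_{\{0,1,\dots,j\}}$ is a weak equivalence. $X$ is right $2$-Segal if for every $n\ge3$ and $0\le j\le n$ the map $X_n\to X_{\{0,1,\dots,j,n\}}\times^h_{X_{\{j,n\}}}X_{\{j,j+1,\dots,n\}}$ is a weak equivalence. $X$ is upper $2$-Segal if for all $0<i<n$ the commutative square $$\begin{array}{ccc}X_{n+1}&\xrightarrow{d_0}&X_n\\ {\scriptstyle d_{i+1}}\downarrow&&\downarrow{\scriptstyle d_i}\\ X_n&\xrightarrow{d_0}&X_{n-1}\end{array}$$ is homotopy cartesian. $X$ is lower $2$-Segal if for all $0<i<n$ the commutative square $$\begin{array}{ccc}X_{n+1}&\xrightarrow{d_{n+1}}&X_n\\ {\scriptstyle d_i}\downarrow&&\downarrow{\scriptstyle d_i}\\ X_n&\xrightarrow{d_n}&X_{n-1}\end{array}$$ is homotopy cartesian. *)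

theory Defs
  imports Main "HOL-Library.FuncSet"
begin

section \<open>Categories, functors and finite limits\<close>

record ('o, 'm) category =
  Obj :: "'o set"
  Arr :: "'m set"
  Dom :: "'m \<Rightarrow> 'o"
  Cod :: "'m \<Rightarrow> 'o"
  Ident :: "'o \<Rightarrow> 'm"
  Comp :: "'m \<Rightarrow> 'm \<Rightarrow> 'm"  (infixl "\<cdot>\<index>" 70)

definition hom :: "('o, 'm, 'z) category_scheme \<Rightarrow> 'o \<Rightarrow> 'o \<Rightarrow> 'm set" where
  "hom C a b = {f \<in> Arr C. Dom C f = a \<and> Cod C f = b}"

locale category =
  fixes C :: "('o, 'm, 'z) category_scheme" (structure)
  assumes Dom_Obj: "f \<in> Arr C \<Longrightarrow> Dom C f \<in> Obj C"
    and Cod_Obj: "f \<in> Arr C \<Longrightarrow> Cod C f \<in> Obj C"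
    and Ident_hom: "a \<in> Obj C \<Longrightarrow> Ident C a \<in> hom C a a"
    and Comp_hom: "f \<in> hom C a b \<Longrightarrow> g \<in> hom C b c \<Longrightarrow> g \<cdot> f \<in> hom C a c"
    and Comp_Ident: "f \<in> hom C a b \<Longrightarrow> f \<cdot> Ident C a = f"
    and Ident_Comp: "f \<in> hom C a b \<Longrightarrow> Ident C b \<cdot> f = f"
    and Comp_assoc: "f \<in> hom C a b \<Longrightarrow> g \<in> hom C b c \<Longrightarrow> h \<in> hom C c d
      \<Longrightarrow> (h \<cdot> g) \<cdot> f = h \<cdot> (g \<cdot> f)"

definition op_category :: "('o, 'm, 'z) category_scheme \<Rightarrow> ('o, 'm) category" where
  "op_category C = \<lparr>Obj = Obj C, Arr = Arr C, Dom = Cod C, Cod = Dom C,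
     Ident = Ident C, Comp = (\<lambda>g f. f \<cdot>\<^bsub>C\<^esub> g)\<rparr>"

record ('o1, 'm1, 'o2, 'm2) functor_data =
  on_obj :: "'o1 \<Rightarrow> 'o2"
  on_arr :: "'m1 \<Rightarrow> 'm2"

definition is_functor :: "('o1, 'm1, 'y) category_scheme \<Rightarrow> ('o2, 'm2, 'z) category_scheme \<Rightarrow>
    ('o1, 'm1, 'o2, 'm2) functor_data \<Rightarrow> bool" where
  "is_functor J C F \<longleftrightarrow>
     (\<forall>a\<in>Obj J. on_obj F a \<in> Obj C) \<and>
     (\<forall>a\<in>Obj J. \<forall>b\<in>Obj J. \<forall>f\<in>hom J a b. on_arr F f \<in> hom C (on_obj F a) (on_obj F b)) \<and>
     (\<forall>a\<in>Obj J. on_arr F (Ident J a) = Ident C (on_obj F a)) \<and>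
     (\<forall>f\<in>Arr J. \<forall>g\<in>Arr J. Cod J f = Dom J g \<longrightarrow>
        on_arr F (g \<cdot>\<^bsub>J\<^esub> f) = on_arr F g \<cdot>\<^bsub>C\<^esub> on_arr F f)"

definition is_cone :: "('o1, 'm1, 'y) category_scheme \<Rightarrow> ('o2, 'm2, 'z) category_scheme \<Rightarrow>
    ('o1, 'm1, 'o2, 'm2) functor_data \<Rightarrow> 'o2 \<Rightarrow> ('o1 \<Rightarrow> 'm2) \<Rightarrow> bool" where
  "is_cone J C F L l \<longleftrightarrow> L \<in> Obj C \<and>
     (\<forall>j\<in>Obj J. l j \<in> hom C L (on_obj F j)) \<and>
     (\<forall>u\<in>Arr J. on_arr F u \<cdot>\<^bsub>C\<^esub> l (Dom J u) = l (Cod J u))"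

definition is_limit :: "('o1, 'm1, 'y) category_scheme \<Rightarrow> ('o2, 'm2, 'z) category_scheme \<Rightarrow>
    ('o1, 'm1, 'o2, 'm2) functor_data \<Rightarrow> 'o2 \<Rightarrow> ('o1 \<Rightarrow> 'm2) \<Rightarrow> bool" where
  "is_limit J C F L l \<longleftrightarrow> is_cone J C F L l \<and>
     (\<forall>K k. is_cone J C F K k \<longrightarrow>
        (\<exists>!h. h \<in> hom C K L \<and> (\<forall>j\<in>Obj J. l j \<cdot>\<^bsub>C\<^esub> h = k j)))"

text \<open>Every finite category is isomorphic to one whose objects and arrows are natural numbers,
  so quantifying over index categories of this type covers all finite diagrams.\<close>

definition has_finite_limits :: "('o, 'm, 'z) category_scheme \<Rightarrow> bool" where
  "has_finite_limits C \<longleftrightarrow>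
     (\<forall>(J :: (nat, nat) category) F.
        category J \<and> finite (Obj J) \<and> finite (Arr J) \<and> is_functor J C F
        \<longrightarrow> (\<exists>L l. is_limit J C F L l))"

definition has_finite_colimits :: "('o, 'm, 'z) category_scheme \<Rightarrow> bool" where
  "has_finite_colimits C \<longleftrightarrow> has_finite_limits (op_category C)"

definition is_terminal :: "('o, 'm, 'z) category_scheme \<Rightarrow> 'o \<Rightarrow> bool" where
  "is_terminal C t \<longleftrightarrow> t \<in> Obj C \<and> (\<forall>a\<in>Obj C. \<exists>!f. f \<in> hom C a t)"

text \<open>In the next two definitions the arguments \<open>p q f g\<close> denote the square with top edge
  \<open>p : A \<rightarrow> B\<close>, left edge \<open>q : A \<rightarrow> B'\<close>, right edge \<open>f : B \<rightarrow> E\<close> and bottom edge \<open>g : B' \<rightarrow> E\<close>.\<close>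

definition commutative_square ::
    "('o, 'm, 'z) category_scheme \<Rightarrow> 'm \<Rightarrow> 'm \<Rightarrow> 'm \<Rightarrow> 'm \<Rightarrow> bool" where
  "commutative_square C p q f g \<longleftrightarrow>
     p \<in> Arr C \<and> q \<in> Arr C \<and> f \<in> Arr C \<and> g \<in> Arr C \<and>
     Dom C p = Dom C q \<and> Cod C p = Dom C f \<and> Cod C q = Dom C g \<and> Cod C f = Cod C g \<and>
     f \<cdot>\<^bsub>C\<^esub> p = g \<cdot>\<^bsub>C\<^esub> q"

definition is_pullback ::
    "('o, 'm, 'z) category_scheme \<Rightarrow> 'm \<Rightarrow> 'm \<Rightarrow> 'm \<Rightarrow> 'm \<Rightarrow> bool" where
  "is_pullback C p q f g \<longleftrightarrow> commutative_square C p q f g \<and>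
     (\<forall>p' q'. commutative_square C p' q' f g \<longrightarrow>
        (\<exists>!h. h \<in> hom C (Dom C p') (Dom C p) \<and> p \<cdot>\<^bsub>C\<^esub> h = p' \<and> q \<cdot>\<^bsub>C\<^esub> h = q'))"


section \<open>Model categories\<close>

record ('o, 'm) model_structure = "('o, 'm) category" +
  Weq :: "'m set"
  Fib :: "'m set"
  Cof :: "'m set"

definition is_retract :: "('o, 'm, 'z) category_scheme \<Rightarrow> 'm \<Rightarrow> 'm \<Rightarrow> bool" where
  "is_retract C f g \<longleftrightarrow> f \<in> Arr C \<and> g \<in> Arr C \<and>
     (\<exists>i r j s.
        i \<in> hom C (Dom C f) (Dom C g) \<and> r \<in> hom C (Dom C g) (Dom C f) \<and>
        j \<in> hom C (Cod C f) (Cod C g) \<and> s \<in> hom C (Cod C g) (Cod C f) \<and>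
        r \<cdot>\<^bsub>C\<^esub> i = Ident C (Dom C f) \<and> s \<cdot>\<^bsub>C\<^esub> j = Ident C (Cod C f) \<and>
        g \<cdot>\<^bsub>C\<^esub> i = j \<cdot>\<^bsub>C\<^esub> f \<and> f \<cdot>\<^bsub>C\<^esub> r = s \<cdot>\<^bsub>C\<^esub> g)"

definition has_lifting :: "('o, 'm, 'z) category_scheme \<Rightarrow> 'm \<Rightarrow> 'm \<Rightarrow> bool" where
  "has_lifting C i p \<longleftrightarrow>
     (\<forall>u v. commutative_square C u i p v \<longrightarrow>
        (\<exists>h \<in> hom C (Cod C i) (Dom C p). h \<cdot>\<^bsub>C\<^esub> i = u \<and> p \<cdot>\<^bsub>C\<^esub> h = v))"

definition wide_subcategory :: "('o, 'm, 'z) category_scheme \<Rightarrow> 'm set \<Rightarrow> bool" where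
  "wide_subcategory C S \<longleftrightarrow> S \<subseteq> Arr C \<and> (\<forall>a\<in>Obj C. Ident C a \<in> S) \<and>
     (\<forall>f\<in>S. \<forall>g\<in>S. Cod C f = Dom C g \<longrightarrow> g \<cdot>\<^bsub>C\<^esub> f \<in> S)"

text \<open>Quillen's closed model categories: only finite limits and colimits are required, and
  the factorizations need not be functorial.\<close>

locale model_category = category M
  for M :: "('o, 'm, 'z) model_structure_scheme" (structure) +
  assumes finite_limits: "has_finite_limits M"
    and finite_colimits: "has_finite_colimits M"
    and Weq_wide: "wide_subcategory M (Weq M)"
    and Fib_wide: "wide_subcategory M (Fib M)"
    and Cof_wide: "wide_subcategory M (Cof M)"
    and two_of_three:
      "\<And>f g. f \<in> Arr M \<Longrightarrow> g \<in> Arr M \<Longrightarrow> Cod M f = Dom M g \<Longrightarrow>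
         (f \<in> Weq M \<and> g \<in> Weq M \<longrightarrow> g \<cdot> f \<in> Weq M) \<and>
         (f \<in> Weq M \<and> g \<cdot> f \<in> Weq M \<longrightarrow> g \<in> Weq M) \<and>
         (g \<in> Weq M \<and> g \<cdot> f \<in> Weq M \<longrightarrow> f \<in> Weq M)"
    and Weq_retract: "\<And>f g. is_retract M f g \<Longrightarrow> g \<in> Weq M \<Longrightarrow> f \<in> Weq M"
    and Fib_retract: "\<And>f g. is_retract M f g \<Longrightarrow> g \<in> Fib M \<Longrightarrow> f \<in> Fib M"
    and Cof_retract: "\<And>f g. is_retract M f g \<Longrightarrow> g \<in> Cof M \<Longrightarrow> f \<in> Cof M"
    and lift_Cof: "\<And>i p. i \<in> Cof M \<Longrightarrow> p \<in> Fib M \<inter> Weq M \<Longrightarrow> has_lifting M i p"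
    and lift_acyclic_Cof: "\<And>i p. i \<in> Cof M \<inter> Weq M \<Longrightarrow> p \<in> Fib M \<Longrightarrow> has_lifting M i p"
    and factor_Cof_acyclic_Fib:
      "\<And>f. f \<in> Arr M \<Longrightarrow> \<exists>i p. i \<in> Cof M \<and> p \<in> Fib M \<inter> Weq M \<and>
         Dom M i = Dom M f \<and> Cod M i = Dom M p \<and> Cod M p = Cod M f \<and> p \<cdot> i = f"
    and factor_acyclic_Cof_Fib:
      "\<And>f. f \<in> Arr M \<Longrightarrow> \<exists>i p. i \<in> Cof M \<inter> Weq M \<and> p \<in> Fib M \<and>
         Dom M i = Dom M f \<and> Cod M i = Dom M p \<and> Cod M p = Cod M f \<and> p \<cdot> i = f"

definition fibrant :: "('o, 'm, 'z) model_structure_scheme \<Rightarrow> 'o \<Rightarrow> bool" where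
  "fibrant M a \<longleftrightarrow> (\<exists>t f. is_terminal M t \<and> f \<in> hom M a t \<and> f \<in> Fib M)"


section \<open>Homotopy pullbacks\<close>

text \<open>A fibrant replacement of the cospan \<open>B \<rightarrow> E \<leftarrow> B'\<close> given by \<open>f\<close> and \<open>g\<close>, for the injective
  model structure on cospans: a levelwise weak equivalence \<open>(b, b', e)\<close> to a cospan \<open>f', g'\<close> of
  fibrations with fibrant target.\<close>

definition fibrant_replacement_cospan :: "('o, 'm, 'z) model_structure_scheme \<Rightarrow>
    'm \<Rightarrow> 'm \<Rightarrow> 'm \<Rightarrow> 'm \<Rightarrow> 'm \<Rightarrow> 'm \<Rightarrow> 'm \<Rightarrow> bool" where
  "fibrant_replacement_cospan M f g b b' e f' g' \<longleftrightarrow>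
     f \<in> Arr M \<and> g \<in> Arr M \<and> Cod M f = Cod M g \<and>
     b \<in> Weq M \<and> b' \<in> Weq M \<and> e \<in> Weq M \<and>
     commutative_square M b f f' e \<and> commutative_square M b' g g' e \<and>
     f' \<in> Fib M \<and> g' \<in> Fib M \<and> fibrant M (Cod M e)"

text \<open>The homotopy pullback is the pullback of a fibrant replacement, with projections \<open>p'\<close> and
  \<open>q'\<close> to the replaced objects; it is determined up to weak equivalence.\<close>

definition is_homotopy_pullback :: "('o, 'm, 'z) model_structure_scheme \<Rightarrow>
    'm \<Rightarrow> 'm \<Rightarrow> 'm \<Rightarrow> 'm \<Rightarrow> 'm \<Rightarrow> 'm \<Rightarrow> bool" where
  "is_homotopy_pullback M f g b b' p' q' \<longleftrightarrow>
     (\<exists>e f' g'. fibrant_replacement_cospan M f g b b' e f' g' \<and> is_pullback M p' q' f' g')"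

text \<open>The commutative square \<open>p, q, f, g\<close> is homotopy cartesian if the map \<open>u\<close> that it induces from
  its initial corner to the homotopy pullback of \<open>f\<close> and \<open>g\<close> is a weak equivalence.  Whether this
  holds does not depend on the choice of homotopy pullback.\<close>

definition homotopy_cartesian ::
    "('o, 'm, 'z) model_structure_scheme \<Rightarrow> 'm \<Rightarrow> 'm \<Rightarrow> 'm \<Rightarrow> 'm \<Rightarrow> bool" where
  "homotopy_cartesian M p q f g \<longleftrightarrow> commutative_square M p q f g \<and>
     (\<exists>b b' p' q' u. is_homotopy_pullback M f g b b' p' q' \<and>
        u \<in> hom M (Dom M p) (Dom M p') \<and>
        p' \<cdot>\<^bsub>M\<^esub> u = b \<cdot>\<^bsub>M\<^esub> p \<and> q' \<cdot>\<^bsub>M\<^esub> u = b' \<cdot>\<^bsub>M\<^esub> q \<and> u \<in> Weq M)"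


section \<open>Simplicial objects\<close>

text \<open>The object \<open>[n] = {0 < \<dots> < n}\<close> of the simplex category is represented by \<open>n\<close>, and a monotone
  map \<open>\<alpha> : [m] \<rightarrow> [n]\<close> by the triple \<open>(m, \<alpha>, n)\<close> with \<open>\<alpha>\<close> extensional, so that arrows
  are equal exactly when they agree on \<open>[m]\<close>.\<close>

type_synonym simplex_arrow = "nat \<times> (nat \<Rightarrow> nat) \<times> nat"

definition Delta :: "(nat, simplex_arrow) category" where
  "Delta = \<lparr>Obj = UNIV,
     Arr = {(m, \<alpha>, n). \<alpha> \<in> {..m} \<rightarrow>\<^sub>E {..n} \<and> mono_on {..m} \<alpha>},
     Dom = (\<lambda>(m, \<alpha>, n). m),
     Cod = (\<lambda>(m, \<alpha>, n). n),
     Ident = (\<lambda>n. (n, restrict (\<lambda>k. k) {..n}, n)),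
     Comp = (\<lambda>(n', \<beta>, p) (m, \<alpha>, n). (m, compose {..m} \<beta> \<alpha>, p))\<rparr>"

type_synonym ('o, 'm) simplicial = "(nat, simplex_arrow, 'o, 'm) functor_data"

definition simplicial_object ::
    "('o, 'm, 'z) category_scheme \<Rightarrow> ('o, 'm) simplicial \<Rightarrow> bool" where
  "simplicial_object C X \<longleftrightarrow> is_functor (op_category Delta) C X"

definition coface :: "nat \<Rightarrow> nat \<Rightarrow> simplex_arrow" where
  "coface n i = (n - 1, restrict (\<lambda>k. if k < i then k else k + 1) {..n - 1}, n)"

text \<open>The face map \<open>d\<^sub>i : X\<^sub>n \<rightarrow> X\<^sub>n\<^sub>-\<^sub>1\<close>.\<close>

definition face :: "('o, 'm) simplicial \<Rightarrow> nat \<Rightarrow> nat \<Rightarrow> 'm" where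
  "face X n i = on_arr X (coface n i)"

text \<open>For nonempty finite sets \<open>I \<subseteq> J\<close> of naturals, the inclusion read as a monotone map
  \<open>[|I| - 1] \<rightarrow> [|J| - 1]\<close>: the \<open>k\<close>-th smallest element of \<open>I\<close> goes to its position in \<open>J\<close>.\<close>

definition inclusion :: "nat set \<Rightarrow> nat set \<Rightarrow> simplex_arrow" where
  "inclusion I J =
     (card I - 1,
      restrict (\<lambda>k. card {y \<in> J. y < sorted_list_of_set I ! k}) {..card I - 1},
      card J - 1)"

text \<open>The restriction map \<open>X\<^sub>J \<rightarrow> X\<^sub>I\<close> for \<open>I \<subseteq> J\<close>, where \<open>X\<^sub>I\<close> is \<open>on_obj X (card I - 1)\<close>.\<close>

definition restr :: "('o, 'm) simplicial \<Rightarrow> nat set \<Rightarrow> nat set \<Rightarrow> 'm" where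
  "restr X J I = on_arr X (inclusion I J)"


lemma category_Delta: "category Delta"
  by unfold_locales
    (auto simp: Delta_def hom_def mono_on_def PiE_iff compose_def restrict_def extensional_def fun_eq_iff)

lemma category_op_category: "category C \<Longrightarrow> category (op_category C)"
  unfolding category_def op_category_def hom_def by auto

lemma inclusion_hom:
  assumes "finite J" "I \<subseteq> J" "I \<noteq> {}"
  shows "inclusion I J \<in> hom Delta (card I - 1) (card J - 1)"
proof -
  have fI: "finite I" using assms finite_subset by blast
  have cI: "card I > 0" using fI assms by (simp add: card_gt_0_iff)
  have le: "card {y \<in> J. y < sorted_list_of_set I ! k} \<le> card J - 1" if "k \<le> card I - 1" for k
  proof -
    have "sorted_list_of_set I ! k \<in> set (sorted_list_of_set I)"
      using that cI by (intro nth_mem) auto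
    then have "sorted_list_of_set I ! k \<in> J" using assms fI by auto
    then have "{y \<in> J. y < sorted_list_of_set I ! k} \<subset> J" by blast
    then have "card {y \<in> J. y < sorted_list_of_set I ! k} < card J"
      using assms(1) psubset_card_mono by blast
    then show ?thesis by simp
  qed
  have mono: "card {y \<in> J. y < sorted_list_of_set I ! k} \<le> card {y \<in> J. y < sorted_list_of_set I ! l}"
    if "k \<le> l" "l \<le> card I - 1" for k l
  proof (rule card_mono)
    have "sorted_list_of_set I ! k \<le> sorted_list_of_set I ! l"
      using that cI by (intro sorted_nth_mono) auto
    then show "{y \<in> J. y < sorted_list_of_set I ! k} \<subseteq> {y \<in> J. y < sorted_list_of_set I ! l}" by auto
  qed (use assms in auto)
  show ?thesis
    using le mono by (auto simp: inclusion_def Delta_def hom_def mono_on_def)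
qed

lemma coface_hom: "0 < n \<Longrightarrow> i \<le> n \<Longrightarrow> coface n i \<in> hom Delta (n - 1) n"
  by (auto simp: coface_def Delta_def hom_def mono_on_def)

lemma sorted_list_of_set_omit:
  assumes "i \<le> n"
  shows "sorted_list_of_set ({0..n} - {i}) = [0..<i] @ [Suc i..<Suc n]"
proof -
  have "sorted_list_of_set (set ([0..<i] @ [Suc i..<Suc n])) = [0..<i] @ [Suc i..<Suc n]"
    by (rule sorted_list_of_set.idem_if_sorted_distinct) (auto simp: sorted_append)
  moreover have "set ([0..<i] @ [Suc i..<Suc n]) = {0..n} - {i}" using assms by auto
  ultimately show ?thesis by simp
qed

lemma coface_eq_inclusion:
  assumes "0 < n" "i \<le> n"
  shows "coface n i = inclusion ({0..n} - {i}) {0..n}"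
proof -
  have "card {y \<in> {0..n}. y < x} = x" if "x \<le> n" for x
  proof -
    have "{y \<in> {0..n}. y < x} = {..<x}" using that by auto
    then show ?thesis by simp
  qed
  then show ?thesis using assms
    by (auto simp: coface_def inclusion_def sorted_list_of_set_omit nth_append fun_eq_iff restrict_def simp del: upt_Suc)
qed


section \<open>2-Segal conditions\<close>

definition left_2_Segal ::
    "('o, 'm, 'z) model_structure_scheme \<Rightarrow> ('o, 'm) simplicial \<Rightarrow> bool" where
  "left_2_Segal M X \<longleftrightarrow> (\<forall>n\<ge>3. \<forall>j\<le>n.
     homotopy_cartesian M
       (restr X {0..n} ({0} \<union> {j..n})) (restr X {0..n} {0..j})
       (restr X ({0} \<union> {j..n}) {0, j}) (restr X {0..j} {0, j}))"

definition right_2_Segal ::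
    "('o, 'm, 'z) model_structure_scheme \<Rightarrow> ('o, 'm) simplicial \<Rightarrow> bool" where
  "right_2_Segal M X \<longleftrightarrow> (\<forall>n\<ge>3. \<forall>j\<le>n.
     homotopy_cartesian M
       (restr X {0..n} ({0..j} \<union> {n})) (restr X {0..n} {j..n})
       (restr X ({0..j} \<union> {n}) {j, n}) (restr X {j..n} {j, n}))"

definition upper_2_Segal ::
    "('o, 'm, 'z) model_structure_scheme \<Rightarrow> ('o, 'm) simplicial \<Rightarrow> bool" where
  "upper_2_Segal M X \<longleftrightarrow> (\<forall>n i. 0 < i \<and> i < n \<longrightarrow>
     homotopy_cartesian M
       (face X (n + 1) 0) (face X (n + 1) (i + 1)) (face X n i) (face X n 0))"

definition lower_2_Segal ::
    "('o, 'm, 'z) model_structure_scheme \<Rightarrow> ('o, 'm) simplicial \<Rightarrow> bool" where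
  "lower_2_Segal M X \<longleftrightarrow> (\<forall>n i. 0 < i \<and> i < n \<longrightarrow>
     homotopy_cartesian M
       (face X (n + 1) (n + 1)) (face X (n + 1) i) (face X n i) (face X n n))"

end

theory Submission
  imports Defs
begin

text \<open>Any two fibrant replacements of a cospan are dominated by a third one that maps to both by
  acyclic fibrations of cospans: factor the map into their product.  As limits preserve such acyclic
  fibrations, being homotopy cartesian does not depend on the chosen replacement, and pasting two
  squares side by side reduces to pasting pullbacks, because the homotopy pullback of the right
  square can be reused in a replacement for the left one.

  The squares omitting \<open>1, \<dots>, j - 1\<close> against the last vertex interpolate between the two Segal
  conditions: horizontally they are composites of lower squares, and vertically their composites
  are the left squares, so cancelling pasted squares gives both implications.  Reversing the order
  of the vertices turns lower and left into upper and right.\<close>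

section \<open>Pullbacks and lifting\<close>

text \<open>No properness is available: the base change of a weak equivalence along a fibration need
  not be one. Hence replacing a single leg of a cospan is not enough, and levelwise weak
  equivalences of cospans are never pulled back directly. What pullbacks do respect are lifting
  properties. A comparison of cospans is therefore required to lift at the corner and, in each leg,
  relative to the corner; it then induces an acyclic fibration of pullbacks.

  Pasting cancels in one direction only: once the square next to the final corner is homotopy
  cartesian, the other square is so exactly when the composite is. For vertex sets
  \<open>A' \<subseteq> A \<subseteq> K\<close> and \<open>B\<close>, the square next to the final
  corner has all its vertices in \<open>A\<close>; this is what makes induction on the number of
  vertices possible.

  The bound \<open>n \<ge> 3\<close> in the left and right conditions loses nothing: for
  \<open>n \<le> 2\<close> one of the two vertex sets is always all of \<open>{0..n}\<close>, and
  such a square is homotopy cartesian for any \<open>X\<close>. The order is reversed on vertex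
  sets, not on \<open>X\<close>, which is why the combinatorics is stated for an abstract predicate
  on triples of sets.\<close>

lemma (in category) hom_iff: "f \<in> hom C a b \<longleftrightarrow> f \<in> Arr C \<and> Dom C f = a \<and> Cod C f = b"
  by (auto simp: hom_def)

context category
begin

lemma hom_Obj: "f \<in> hom C a b \<Longrightarrow> a \<in> Obj C" "f \<in> hom C a b \<Longrightarrow> b \<in> Obj C"
  using Dom_Obj[of f] Cod_Obj[of f] by (auto simp: hom_iff)

lemma comp_arr [simp]: "f \<in> Arr C \<Longrightarrow> g \<in> Arr C \<Longrightarrow> Cod C f = Dom C g \<Longrightarrow> g \<cdot> f \<in> Arr C"
  and dom_comp [simp]: "f \<in> Arr C \<Longrightarrow> g \<in> Arr C \<Longrightarrow> Cod C f = Dom C g \<Longrightarrow> Dom C (g \<cdot> f) = Dom C f"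
  and cod_comp [simp]: "f \<in> Arr C \<Longrightarrow> g \<in> Arr C \<Longrightarrow> Cod C f = Dom C g \<Longrightarrow> Cod C (g \<cdot> f) = Cod C g"
  using Comp_hom[of f "Dom C f" "Cod C f" g "Cod C g"] by (auto simp: hom_iff)

lemma assoc: "f \<in> Arr C \<Longrightarrow> g \<in> Arr C \<Longrightarrow> h \<in> Arr C \<Longrightarrow> Cod C f = Dom C g \<Longrightarrow> Cod C g = Dom C h
    \<Longrightarrow> (h \<cdot> g) \<cdot> f = h \<cdot> (g \<cdot> f)"
  using Comp_assoc[of f "Dom C f" "Dom C g" g "Dom C h" h "Cod C h"] by (auto simp: hom_iff)

lemma ident_simps [simp]:
  "a \<in> Obj C \<Longrightarrow> Ident C a \<in> Arr C"
  "a \<in> Obj C \<Longrightarrow> Dom C (Ident C a) = a"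
  "a \<in> Obj C \<Longrightarrow> Cod C (Ident C a) = a"
  using Ident_hom by (auto simp: hom_iff)

lemma comp_ident [simp]: "f \<in> Arr C \<Longrightarrow> Dom C f = a \<Longrightarrow> f \<cdot> Ident C a = f"
  and ident_comp [simp]: "f \<in> Arr C \<Longrightarrow> Cod C f = b \<Longrightarrow> Ident C b \<cdot> f = f"
  using Comp_Ident Ident_Comp by (auto simp: hom_iff)

lemma comp_square:
  assumes "f \<cdot> p = g \<cdot> q" "p \<in> hom C a b" "f \<in> hom C b e" "q \<in> hom C a b'" "g \<in> hom C b' e" "x \<in> hom C k a"
  shows "f \<cdot> (p \<cdot> x) = g \<cdot> (q \<cdot> x)"
  using Comp_assoc[OF assms(6,2,3)] Comp_assoc[OF assms(6,4,5)] assms(1) by simp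

lemma comp_triangle:
  assumes "f \<cdot> p = g" "p \<in> hom C a b" "f \<in> hom C b e" "x \<in> hom C k a"
  shows "f \<cdot> (p \<cdot> x) = g \<cdot> x"
  using Comp_assoc[OF assms(4,2,3)] assms(1) by simp

lemma commutative_squareI:
  assumes "p \<in> hom C a b" "q \<in> hom C a b'" "f \<in> hom C b e" "g \<in> hom C b' e" "f \<cdot> p = g \<cdot> q"
  shows "commutative_square C p q f g"
  using assms by (auto simp: commutative_square_def hom_iff)

lemma commutative_squareE:
  assumes "commutative_square C p q f g"
  obtains a b b' e where "p \<in> hom C a b" "q \<in> hom C a b'" "f \<in> hom C b e" "g \<in> hom C b' e"
    "f \<cdot> p = g \<cdot> q"
  using assms by (auto simp: commutative_square_def hom_iff)

lemma commutative_square_sym: "commutative_square C p q f g \<longleftrightarrow> commutative_square C q p g f"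
  by (auto simp: commutative_square_def)

lemma is_pullback_sym: "is_pullback C p q f g \<longleftrightarrow> is_pullback C q p g f"
proof -
  have "is_pullback C q p g f" if P: "is_pullback C p q f g" for p q f g
    unfolding is_pullback_def
  proof (intro conjI allI impI)
    show "commutative_square C q p g f"
      using P commutative_square_sym by (simp add: is_pullback_def)
    fix p' q' assume "commutative_square C p' q' g f"
    then have "commutative_square C q' p' f g" by (simp add: commutative_square_sym)
    then have "\<exists>!h. h \<in> hom C (Dom C q') (Dom C p) \<and> p \<cdot> h = q' \<and> q \<cdot> h = p'"
      using P by (simp add: is_pullback_def)
    moreover have "Dom C q' = Dom C p'" "Dom C p = Dom C q"
      using \<open>commutative_square C p' q' g f\<close> P by (auto simp: is_pullback_def commutative_square_def)
    ultimately show "\<exists>!h. h \<in> hom C (Dom C p') (Dom C q) \<and> q \<cdot> h = p' \<and> p \<cdot> h = q'"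
      by (simp add: conj_ac)
  qed
  then show ?thesis by blast
qed

lemma is_pullback_homE:
  assumes "is_pullback C p q f g"
  obtains a b b' e where "p \<in> hom C a b" "q \<in> hom C a b'" "f \<in> hom C b e" "g \<in> hom C b' e"
    "f \<cdot> p = g \<cdot> q"
  using assms commutative_squareE[of p q f g] unfolding is_pullback_def by blast

lemma is_pullback_induced:
  assumes P: "is_pullback C p q f g" and h: "p \<in> hom C a b" "f \<in> hom C b e" "g \<in> hom C b' e"
    and xy: "x \<in> hom C k b" "y \<in> hom C k b'" "f \<cdot> x = g \<cdot> y"
  shows "\<exists>h\<in>hom C k a. p \<cdot> h = x \<and> q \<cdot> h = y"
proof -
  have "commutative_square C x y f g" using commutative_squareI[OF xy(1,2) h(2,3) xy(3)] .
  then have "\<exists>!h. h \<in> hom C (Dom C x) (Dom C p) \<and> p \<cdot> h = x \<and> q \<cdot> h = y"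
    using P by (simp add: is_pullback_def)
  moreover have "Dom C x = k" "Dom C p = a" using xy h by (auto simp: hom_iff)
  ultimately show ?thesis by blast
qed

lemma is_pullback_unique:
  assumes P: "is_pullback C p q f g" and p: "p \<in> hom C a b" and h: "h \<in> hom C k a" "h' \<in> hom C k a"
    and eq: "p \<cdot> h = p \<cdot> h'" "q \<cdot> h = q \<cdot> h'"
  shows "h = h'"
proof -
  obtain a0 b0 b' e where h0: "p \<in> hom C a0 b0" "q \<in> hom C a0 b'" "f \<in> hom C b0 e" "g \<in> hom C b' e"
    and e: "f \<cdot> p = g \<cdot> q"
    using P by (rule is_pullback_homE)
  have [simp]: "a0 = a" "Dom C p = a" using p h0 by (auto simp: hom_iff)
  note h0 = h0[simplified]
  have "commutative_square C (p \<cdot> h) (q \<cdot> h) f g"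
    using commutative_squareI[OF Comp_hom[OF h(1) h0(1)] Comp_hom[OF h(1) h0(2)] h0(3,4)]
      comp_square[OF e h0(1,3,2,4) h(1)] by blast
  then have "\<exists>!x. x \<in> hom C (Dom C (p \<cdot> h)) (Dom C p) \<and> p \<cdot> x = p \<cdot> h \<and> q \<cdot> x = q \<cdot> h"
    using P by (simp add: is_pullback_def)
  moreover have "Dom C (p \<cdot> h) = k" using Comp_hom[OF h(1) h0(1)] by (simp add: hom_iff)
  ultimately show ?thesis using h eq by auto
qed

lemma is_pullbackI:
  assumes "commutative_square C p q f g"
    and "\<And>k x y. x \<in> hom C k (Dom C f) \<Longrightarrow> y \<in> hom C k (Dom C g) \<Longrightarrow> f \<cdot> x = g \<cdot> y
      \<Longrightarrow> \<exists>h. h \<in> hom C k (Dom C p) \<and> p \<cdot> h = x \<and> q \<cdot> h = y"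
    and "\<And>k h h'. h \<in> hom C k (Dom C p) \<Longrightarrow> h' \<in> hom C k (Dom C p) \<Longrightarrow> p \<cdot> h = p \<cdot> h'
      \<Longrightarrow> q \<cdot> h = q \<cdot> h' \<Longrightarrow> h = h'"
  shows "is_pullback C p q f g"
  unfolding is_pullback_def
proof (intro conjI allI impI)
  fix p' q' assume "commutative_square C p' q' f g"
  then have "p' \<in> hom C (Dom C p') (Dom C f)" "q' \<in> hom C (Dom C p') (Dom C g)" "f \<cdot> p' = g \<cdot> q'"
    by (auto simp: commutative_square_def hom_iff)
  then show "\<exists>!h. h \<in> hom C (Dom C p') (Dom C p) \<and> p \<cdot> h = p' \<and> q \<cdot> h = q'"
    using assms(2,3) by metis
qed (fact assms(1))

text \<open>Cones factor through the right square and after that through the left one, and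
  uniqueness follows the same route. In \<open>homotopy_cartesian_paste\<close> this lets the left
  square and the composite square share one homotopy pullback.\<close>

lemma is_pullback_paste:
  assumes right: "is_pullback C p q f g" and left: "is_pullback C r s q h"
  shows "is_pullback C (p \<cdot> r) s f (g \<cdot> h)"
proof -
  obtain b c b' c' where hr: "p \<in> hom C b c" "q \<in> hom C b b'" "f \<in> hom C c c'" "g \<in> hom C b' c'"
    and er: "f \<cdot> p = g \<cdot> q"
    using right by (rule is_pullback_homE)
  obtain a b0 a' b0' where "r \<in> hom C a b0" "s \<in> hom C a a'" "q \<in> hom C b0 b0'" "h \<in> hom C a' b0'"
    and el: "q \<cdot> r = h \<cdot> s"
    using left by (rule is_pullback_homE)
  then have hl: "r \<in> hom C a b" "s \<in> hom C a a'" "h \<in> hom C a' b'"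
    using hr by (auto simp: hom_iff)
  have dom: "Dom C f = c" "Dom C (g \<cdot> h) = a'" "Dom C (p \<cdot> r) = a"
    using hr Comp_hom[OF hl(3) hr(4)] Comp_hom[OF hl(1) hr(1)] by (auto simp: hom_iff)
  show ?thesis
  proof (rule is_pullbackI)
    have "f \<cdot> (p \<cdot> r) = g \<cdot> (h \<cdot> s)" using comp_square[OF er hr(1,3,2,4) hl(1)] el by simp
    also have "\<dots> = (g \<cdot> h) \<cdot> s" using Comp_assoc[OF hl(2,3) hr(4)] by simp
    finally show "commutative_square C (p \<cdot> r) s f (g \<cdot> h)"
      by (rule commutative_squareI[OF Comp_hom[OF hl(1) hr(1)] hl(2) hr(3) Comp_hom[OF hl(3) hr(4)]])
  next
    fix k x y assume "x \<in> hom C k (Dom C f)" "y \<in> hom C k (Dom C (g \<cdot> h))" and e: "f \<cdot> x = (g \<cdot> h) \<cdot> y"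
    then have x: "x \<in> hom C k c" and y: "y \<in> hom C k a'" by (simp_all add: dom)
    have "f \<cdot> x = g \<cdot> (h \<cdot> y)" using e Comp_assoc[OF y hl(3) hr(4)] by simp
    then obtain z where z: "z \<in> hom C k b" "p \<cdot> z = x" "q \<cdot> z = h \<cdot> y"
      using is_pullback_induced[OF right hr(1,3,4) x Comp_hom[OF y hl(3)]] by blast
    then obtain w where w: "w \<in> hom C k a" "r \<cdot> w = z" "s \<cdot> w = y"
      using is_pullback_induced[OF left hl(1) hr(2) hl(3) z(1) y] by blast
    then show "\<exists>h. h \<in> hom C k (Dom C (p \<cdot> r)) \<and> p \<cdot> r \<cdot> h = x \<and> s \<cdot> h = y"
      using z Comp_assoc[OF w(1) hl(1) hr(1)] dom by auto
  next
    fix k w w' assume "w \<in> hom C k (Dom C (p \<cdot> r))" "w' \<in> hom C k (Dom C (p \<cdot> r))"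
      and e: "p \<cdot> r \<cdot> w = p \<cdot> r \<cdot> w'" "s \<cdot> w = s \<cdot> w'"
    then have w: "w \<in> hom C k a" "w' \<in> hom C k a" by (simp_all add: dom)
    have "r \<cdot> w = r \<cdot> w'"
    proof (rule is_pullback_unique[OF right hr(1) Comp_hom[OF w(1) hl(1)] Comp_hom[OF w(2) hl(1)]])
      show "p \<cdot> (r \<cdot> w) = p \<cdot> (r \<cdot> w')"
        using e Comp_assoc[OF w(1) hl(1) hr(1)] Comp_assoc[OF w(2) hl(1) hr(1)] by simp
      show "q \<cdot> (r \<cdot> w) = q \<cdot> (r \<cdot> w')"
        using e comp_square[OF el hl(1) hr(2) hl(2,3) w(1)] comp_square[OF el hl(1) hr(2) hl(2,3) w(2)] by simp
    qed
    then show "w = w'" using is_pullback_unique[OF left hl(1) w] e(2) by blast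
  qed
qed

text \<open>Serves in \<open>homotopy_cartesian_Weq\<close>, where one leg of the replaced cospan is
  an identity.\<close>

lemma is_pullback_ident:
  assumes g: "g \<in> hom C b e"
  shows "is_pullback C g (Ident C b) (Ident C e) g"
proof -
  note ob = hom_Obj[OF g]
  have dom: "Dom C g = b" "Dom C (Ident C e) = e" using g ob by (simp_all add: hom_iff)
  show ?thesis
  proof (rule is_pullbackI)
    show "commutative_square C g (Ident C b) (Ident C e) g"
      using g ob commutative_squareI[OF g Ident_hom Ident_hom g] Comp_Ident Ident_Comp by simp
    fix k x y assume "x \<in> hom C k (Dom C (Ident C e))" "y \<in> hom C k (Dom C g)" "Ident C e \<cdot> x = g \<cdot> y"
    then show "\<exists>h. h \<in> hom C k (Dom C g) \<and> g \<cdot> h = x \<and> Ident C b \<cdot> h = y"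
      using Ident_Comp unfolding dom by metis
  next
    fix k h h' assume "h \<in> hom C k (Dom C g)" "h' \<in> hom C k (Dom C g)" "Ident C b \<cdot> h = Ident C b \<cdot> h'"
    then show "h = h'" using Ident_Comp unfolding dom by metis
  qed
qed

text \<open>The objects \<open>0\<close>, \<open>1\<close>, \<open>2\<close> have identities \<open>0\<close>, \<open>1\<close>, \<open>2\<close>; the two legs of the
  cospan are \<open>3 : 0 \<rightarrow> 2\<close> and \<open>4 : 1 \<rightarrow> 2\<close>.\<close>

definition cospan_category :: "(nat, nat) category" where
  "cospan_category = \<lparr>Obj = {0, 1, 2}, Arr = {0, 1, 2, 3, 4},
     Dom = (\<lambda>u. if u = 3 then 0 else if u = 4 then 1 else u),
     Cod = (\<lambda>u. if u \<ge> 2 then 2 else u),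
     Ident = (\<lambda>a. a), Comp = (\<lambda>v u. if v \<le> 2 then u else v)\<rparr>"

lemma hom_cospan: "u \<in> hom cospan_category a b \<longleftrightarrow>
    u = 0 \<and> a = 0 \<and> b = 0 \<or> u = 1 \<and> a = 1 \<and> b = 1 \<or> u = 2 \<and> a = 2 \<and> b = 2 \<or>
    u = 3 \<and> a = 0 \<and> b = 2 \<or> u = 4 \<and> a = 1 \<and> b = 2"
  by (auto simp: cospan_category_def hom_def)

lemma category_cospan_category: "category cospan_category"
proof
  fix f g h a b c d
  show "f \<in> hom cospan_category a b \<Longrightarrow> g \<in> hom cospan_category b c \<Longrightarrow> g \<cdot>\<^bsub>cospan_category\<^esub> f \<in> hom cospan_category a c"
    unfolding hom_cospan by (elim disjE) (simp_all add: cospan_category_def)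
  show "f \<in> hom cospan_category a b \<Longrightarrow> g \<in> hom cospan_category b c \<Longrightarrow> h \<in> hom cospan_category c d \<Longrightarrow> 
     (h \<cdot>\<^bsub>cospan_category\<^esub> g) \<cdot>\<^bsub>cospan_category\<^esub> f = h \<cdot>\<^bsub>cospan_category\<^esub> (g \<cdot>\<^bsub>cospan_category\<^esub> f)"
    by (simp add: cospan_category_def)
qed (auto simp: hom_cospan, auto simp: cospan_category_def)

text \<open>\<open>has_finite_limits\<close> speaks only of functors on index categories made of
  natural numbers, so the cospan is encoded as such a functor and its limit is read back as a
  pullback.\<close>

lemma pullback_exists:
  assumes "has_finite_limits C" "f \<in> hom C b e" "g \<in> hom C b' e"
  obtains p q where "is_pullback C p q f g"
proof -
  let ?J = cospan_category
  let ?F = "\<lparr>on_obj = (\<lambda>a. if a = 0 then b else if a = 1 then b' else e),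
             on_arr = (\<lambda>u. if u = 0 then Ident C b else if u = 1 then Ident C b'
               else if u = 2 then Ident C e else if u = 3 then f else g)\<rparr>
             :: (nat, nat, 'o, 'm) functor_data"
  have ob [simp]: "b \<in> Obj C" "b' \<in> Obj C" "e \<in> Obj C"
    using assms hom_Obj by auto
  have fg [simp]: "f \<in> Arr C" "g \<in> Arr C" "Dom C f = b" "Dom C g = b'" "Cod C f = e" "Cod C g = e"
    using assms by (auto simp: hom_iff)
  have "is_functor ?J C ?F"
    by (auto simp: is_functor_def cospan_category_def hom_def)
  then obtain L l where lim: "is_limit ?J C ?F L l"
    using assms(1) category_cospan_category unfolding has_finite_limits_def
    by (force simp: cospan_category_def)
  have cone_iff: "is_cone ?J C ?F K k \<longleftrightarrow>
      k 0 \<in> hom C K b \<and> k 1 \<in> hom C K b' \<and> k 2 \<in> hom C K e \<and> f \<cdot> k 0 = k 2 \<and> g \<cdot> k 1 = k 2" for K k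
    using Dom_Obj by (auto simp: is_cone_def cospan_category_def hom_iff)
  have l: "is_cone ?J C ?F L l" using lim by (simp add: is_limit_def)
  have uni: "\<exists>!h. h \<in> hom C K L \<and> l 0 \<cdot> h = x \<and> l 1 \<cdot> h = y"
    if "x \<in> hom C K b" "y \<in> hom C K b'" "f \<cdot> x = g \<cdot> y" for K x y
  proof -
    let ?k = "\<lambda>j::nat. if j = 0 then x else if j = 1 then y else f \<cdot> x"
    have "is_cone ?J C ?F K ?k" using that by (simp add: cone_iff hom_iff)
    then have "\<exists>!h. h \<in> hom C K L \<and> (\<forall>j\<in>Obj ?J. l j \<cdot> h = ?k j)"
      using lim unfolding is_limit_def by blast
    moreover have "(\<forall>j\<in>Obj ?J. l j \<cdot> h = ?k j) \<longleftrightarrow> l 0 \<cdot> h = x \<and> l 1 \<cdot> h = y" if "h \<in> hom C K L" for h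
    proof -
      \<comment> \<open>The component at the corner 2 is forced by the one at 0, so the limit
        property over three objects reduces to the two projections.\<close>
      have "l 2 \<cdot> h = f \<cdot> (l 0 \<cdot> h)" using l that unfolding cone_iff by (auto simp: hom_iff simp flip: assoc)
      then show ?thesis by (auto simp: cospan_category_def)
    qed
    ultimately show ?thesis by metis
  qed
  have "is_pullback C (l 0) (l 1) f g"
    unfolding is_pullback_def
  proof (intro conjI allI impI)
    show "commutative_square C (l 0) (l 1) f g" using l unfolding cone_iff
      by (auto simp: commutative_square_def hom_iff)
    fix p' q' assume "commutative_square C p' q' f g"
    then show "\<exists>!h. h \<in> hom C (Dom C p') (Dom C (l 0)) \<and> l 0 \<cdot> h = p' \<and> l 1 \<cdot> h = q'"
      using uni[of p' "Dom C p'" q'] l unfolding cone_iff by (auto simp: commutative_square_def hom_iff)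
  qed
  then show ?thesis by (rule that)
qed

lemma terminal_exists:
  assumes "has_finite_limits C"
  obtains t where "is_terminal C t"
proof -
  let ?J = "\<lparr>Obj = {}, Arr = {}, Dom = id, Cod = id, Ident = id, Comp = (\<lambda>v u. u)\<rparr> :: (nat, nat) category"
  let ?F = "\<lparr>on_obj = (\<lambda>a. undefined), on_arr = (\<lambda>u. undefined)\<rparr> :: (nat, nat, 'o, 'm) functor_data"
  have "category ?J" by unfold_locales (auto simp: hom_def)
  moreover have "is_functor ?J C ?F" by (simp add: is_functor_def)
  ultimately obtain L l where "is_limit ?J C ?F L l"
    using assms unfolding has_finite_limits_def by fastforce
  then have "is_terminal C L"
    by (auto simp: is_limit_def is_cone_def is_terminal_def)
  then show ?thesis by (rule that)
qed

end

text \<open>\<open>i\<close> lifts against the gap map from the initial corner of the square \<open>p, q, f, g\<close> to the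
  pullback of \<open>f\<close> and \<open>g\<close> (see \<open>gap_lifting_iff\<close>), said without choosing a pullback.\<close>

definition gap_lifting ::
    "('o, 'm, 'z) category_scheme \<Rightarrow> 'm \<Rightarrow> 'm \<Rightarrow> 'm \<Rightarrow> 'm \<Rightarrow> 'm \<Rightarrow> bool" where
  "gap_lifting C i p q f g \<longleftrightarrow>
     (\<forall>k y x. k \<in> hom C (Dom C i) (Dom C p) \<longrightarrow> y \<in> hom C (Cod C i) (Dom C f) \<longrightarrow>
        x \<in> hom C (Cod C i) (Dom C g) \<longrightarrow> f \<cdot>\<^bsub>C\<^esub> y = g \<cdot>\<^bsub>C\<^esub> x \<longrightarrow>
        p \<cdot>\<^bsub>C\<^esub> k = y \<cdot>\<^bsub>C\<^esub> i \<longrightarrow> q \<cdot>\<^bsub>C\<^esub> k = x \<cdot>\<^bsub>C\<^esub> i \<longrightarrow>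
        (\<exists>h \<in> hom C (Cod C i) (Dom C p). h \<cdot>\<^bsub>C\<^esub> i = k \<and> p \<cdot>\<^bsub>C\<^esub> h = y \<and> q \<cdot>\<^bsub>C\<^esub> h = x))"

context category
begin

section \<open>Lifting against base changes, gap maps and maps of pullbacks\<close>

lemma has_liftingI:
  assumes "i \<in> hom C k l" "p \<in> hom C x y"
    "\<And>u v. u \<in> hom C k x \<Longrightarrow> v \<in> hom C l y \<Longrightarrow> p \<cdot> u = v \<cdot> i \<Longrightarrow> \<exists>h\<in>hom C l x. h \<cdot> i = u \<and> p \<cdot> h = v"
  shows "has_lifting C i p"
  using assms unfolding has_lifting_def commutative_square_def hom_def by force

lemma has_liftingD:
  assumes "has_lifting C i p" "i \<in> hom C k l" "p \<in> hom C x y"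
    "u \<in> hom C k x" "v \<in> hom C l y" "p \<cdot> u = v \<cdot> i"
  shows "\<exists>h\<in>hom C l x. h \<cdot> i = u \<and> p \<cdot> h = v"
proof -
  have "commutative_square C u i p v" using assms commutative_squareI by blast
  moreover have "Cod C i = l" "Dom C p = x" using assms by (auto simp: hom_iff)
  ultimately show ?thesis using assms(1) unfolding has_lifting_def by blast
qed

lemma gap_liftingI:
  assumes "i \<in> hom C k l" "p \<in> hom C a b" "f \<in> hom C b e" "g \<in> hom C b' e"
    "\<And>u y x. u \<in> hom C k a \<Longrightarrow> y \<in> hom C l b \<Longrightarrow> x \<in> hom C l b' \<Longrightarrow> f \<cdot> y = g \<cdot> x
      \<Longrightarrow> p \<cdot> u = y \<cdot> i \<Longrightarrow> q \<cdot> u = x \<cdot> i \<Longrightarrow> \<exists>h\<in>hom C l a. h \<cdot> i = u \<and> p \<cdot> h = y \<and> q \<cdot> h = x"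
  shows "gap_lifting C i p q f g"
  using assms unfolding gap_lifting_def by (simp add: hom_iff)

lemma gap_liftingD:
  assumes "gap_lifting C i p q f g" "i \<in> hom C k l" "p \<in> hom C a b" "f \<in> hom C b e" "g \<in> hom C b' e"
    "u \<in> hom C k a" "y \<in> hom C l b" "x \<in> hom C l b'" "f \<cdot> y = g \<cdot> x" "p \<cdot> u = y \<cdot> i" "q \<cdot> u = x \<cdot> i"
  shows "\<exists>h\<in>hom C l a. h \<cdot> i = u \<and> p \<cdot> h = y \<and> q \<cdot> h = x"
proof -
  have "Dom C i = k" "Cod C i = l" "Dom C p = a" "Dom C f = b" "Dom C g = b'"
    using assms by (auto simp: hom_iff)
  then show ?thesis using assms unfolding gap_lifting_def by blast
qed

lemma has_lifting_pullback:
  assumes P: "is_pullback C p q f g" and i: "i \<in> Arr C" and f: "has_lifting C i f"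
  shows "has_lifting C i q"
proof -
  obtain a b b' e where h: "p \<in> hom C a b" "q \<in> hom C a b'" "f \<in> hom C b e" "g \<in> hom C b' e"
    and eq: "f \<cdot> p = g \<cdot> q"
    using P by (rule is_pullback_homE)
  have ii: "i \<in> hom C (Dom C i) (Cod C i)" using i by (simp add: hom_iff)
  show ?thesis
  proof (rule has_liftingI[OF ii h(2)])
    fix u v assume u: "u \<in> hom C (Dom C i) a" and v: "v \<in> hom C (Cod C i) b'" and e: "q \<cdot> u = v \<cdot> i"
    have "f \<cdot> (p \<cdot> u) = g \<cdot> (v \<cdot> i)" using comp_square[OF eq h(1,3,2,4) u] e by simp
    also have "\<dots> = (g \<cdot> v) \<cdot> i" using Comp_assoc[OF ii v h(4)] by simp
    finally obtain y where y: "y \<in> hom C (Cod C i) b" "y \<cdot> i = p \<cdot> u" "f \<cdot> y = g \<cdot> v"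
      using has_liftingD[OF f ii h(3) Comp_hom[OF u h(1)] Comp_hom[OF v h(4)]] by blast
    obtain z where z: "z \<in> hom C (Cod C i) a" "p \<cdot> z = y" "q \<cdot> z = v"
      using is_pullback_induced[OF P h(1,3,4) y(1) v y(3)] by blast
    have "z \<cdot> i = u"
    proof (rule is_pullback_unique[OF P h(1) Comp_hom[OF ii z(1)] u])
      show "p \<cdot> (z \<cdot> i) = p \<cdot> u" using Comp_assoc[OF ii z(1) h(1)] z y by simp
      show "q \<cdot> (z \<cdot> i) = q \<cdot> u" using Comp_assoc[OF ii z(1) h(2)] z e by simp
    qed
    then show "\<exists>h\<in>hom C (Cod C i) a. h \<cdot> i = u \<and> q \<cdot> h = v" using z by blast
  qed
qed

text \<open>Maps into a pullback are compatible pairs, so a lifting problem against \<open>w\<close>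
  is the same data as a lifting problem for the square. Arguments about the gap map thus transfer to
  squares and back.\<close>

lemma gap_lifting_iff:
  assumes P: "is_pullback C r s f g" and w: "w \<in> hom C a (Dom C r)" and i: "i \<in> Arr C"
  shows "gap_lifting C i (r \<cdot> w) (s \<cdot> w) f g \<longleftrightarrow> has_lifting C i w"
proof -
  obtain c b b' e where h: "r \<in> hom C c b" "s \<in> hom C c b'" "f \<in> hom C b e" "g \<in> hom C b' e"
    and eq: "f \<cdot> r = g \<cdot> s"
    using P by (rule is_pullback_homE)
  have c: "Dom C r = c" using h by (simp add: hom_iff)
  note w = w[unfolded c]
  define k l where "k = Dom C i" and "l = Cod C i"
  have ii: "i \<in> hom C k l" using i by (simp add: hom_iff k_def l_def)
  note rw = Comp_hom[OF w h(1)] and sw = Comp_hom[OF w h(2)]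
  show ?thesis
  proof
    assume G: "gap_lifting C i (r \<cdot> w) (s \<cdot> w) f g"
    show "has_lifting C i w"
    proof (rule has_liftingI[OF ii w])
      fix u v assume u: "u \<in> hom C k a" and v: "v \<in> hom C l c" and e: "w \<cdot> u = v \<cdot> i"
      have "\<exists>x\<in>hom C l a. x \<cdot> i = u \<and> (r \<cdot> w) \<cdot> x = r \<cdot> v \<and> (s \<cdot> w) \<cdot> x = s \<cdot> v"
      proof (rule gap_liftingD[OF G ii rw h(3,4) u Comp_hom[OF v h(1)] Comp_hom[OF v h(2)]])
        show "f \<cdot> (r \<cdot> v) = g \<cdot> (s \<cdot> v)" by (rule comp_square[OF eq h(1,3,2,4) v])
        show "(r \<cdot> w) \<cdot> u = (r \<cdot> v) \<cdot> i" "(s \<cdot> w) \<cdot> u = (s \<cdot> v) \<cdot> i"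
          using Comp_assoc[OF u w] Comp_assoc[OF ii v] h e by auto
      qed
      then obtain x where x: "x \<in> hom C l a" "x \<cdot> i = u" "(r \<cdot> w) \<cdot> x = r \<cdot> v" "(s \<cdot> w) \<cdot> x = s \<cdot> v"
        by blast
      have "w \<cdot> x = v"
        using is_pullback_unique[OF P h(1) Comp_hom[OF x(1) w] v] x Comp_assoc[OF x(1) w] h by auto
      then show "\<exists>h\<in>hom C l a. h \<cdot> i = u \<and> w \<cdot> h = v" using x by blast
    qed
  next
    assume L: "has_lifting C i w"
    show "gap_lifting C i (r \<cdot> w) (s \<cdot> w) f g"
    proof (rule gap_liftingI[OF ii rw h(3,4)])
      fix u y x assume u: "u \<in> hom C k a" and y: "y \<in> hom C l b" and x: "x \<in> hom C l b'"
        and e: "f \<cdot> y = g \<cdot> x" "(r \<cdot> w) \<cdot> u = y \<cdot> i" "(s \<cdot> w) \<cdot> u = x \<cdot> i"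
      obtain v where v: "v \<in> hom C l c" "r \<cdot> v = y" "s \<cdot> v = x"
        using is_pullback_induced[OF P h(1,3,4) y x e(1)] by blast
      have "w \<cdot> u = v \<cdot> i"
      proof (rule is_pullback_unique[OF P h(1) Comp_hom[OF u w] Comp_hom[OF ii v(1)]])
        show "r \<cdot> (w \<cdot> u) = r \<cdot> (v \<cdot> i)" "s \<cdot> (w \<cdot> u) = s \<cdot> (v \<cdot> i)"
          using Comp_assoc[OF u w] Comp_assoc[OF ii v(1)] h e v by auto
      qed
      then obtain z where "z \<in> hom C l a" "z \<cdot> i = u" "w \<cdot> z = v"
        using has_liftingD[OF L ii w u v(1)] by blast
      then show "\<exists>h\<in>hom C l a. h \<cdot> i = u \<and> (r \<cdot> w) \<cdot> h = y \<and> (s \<cdot> w) \<cdot> h = x"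
        using v Comp_assoc[OF _ w] h by auto
    qed
  qed
qed

text \<open>Independent lifts in the two legs need not agree over the corner. Lifting in the corner
  \<open>c\<close> and after that in each leg over the chosen \<open>x\<close> forces agreement, so
  the two lifts glue to a map into the pullback.\<close>

lemma has_lifting_pullback_map:
  assumes P: "is_pullback C p q f g" and P1: "is_pullback C p1 q1 f1 g1"
    and sq: "commutative_square C t f f1 e" "commutative_square C t' g g1 e"
    and w: "w \<in> hom C (Dom C p) (Dom C p1)" "p1 \<cdot> w = t \<cdot> p" "q1 \<cdot> w = t' \<cdot> q"
    and i: "i \<in> Arr C" "has_lifting C i e" "gap_lifting C i t f f1 e" "gap_lifting C i t' g g1 e"
  shows "has_lifting C i w"
proof -
  obtain a b b' c where h: "p \<in> hom C a b" "q \<in> hom C a b'" "f \<in> hom C b c" "g \<in> hom C b' c"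
    and eq: "f \<cdot> p = g \<cdot> q"
    using P by (rule is_pullback_homE)
  obtain a1 b1 b1' c1 where h1: "p1 \<in> hom C a1 b1" "q1 \<in> hom C a1 b1'" "f1 \<in> hom C b1 c1" "g1 \<in> hom C b1' c1"
    and eq1: "f1 \<cdot> p1 = g1 \<cdot> q1"
    using P1 by (rule is_pullback_homE)
  have t: "t \<in> hom C b b1" "t' \<in> hom C b' b1'" "e \<in> hom C c c1"
    and te: "f1 \<cdot> t = e \<cdot> f" "g1 \<cdot> t' = e \<cdot> g"
    using sq h h1 by (auto simp: commutative_square_def hom_iff)
  have a: "Dom C p = a" "Dom C p1 = a1" using h h1 by (auto simp: hom_iff)
  note wh = w(1)[unfolded a]
  define k l where "k = Dom C i" and "l = Cod C i"
  have ii: "i \<in> hom C k l" using i by (simp add: hom_iff k_def l_def)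
  show ?thesis
  proof (rule has_liftingI[OF ii wh])
    fix u v assume u: "u \<in> hom C k a" and v: "v \<in> hom C l a1" and wu: "w \<cdot> u = v \<cdot> i"
    note pu = Comp_hom[OF u h(1)] and qu = Comp_hom[OF u h(2)]
      and pv = Comp_hom[OF v h1(1)] and qv = Comp_hom[OF v h1(2)]
    have tp: "t \<cdot> (p \<cdot> u) = (p1 \<cdot> v) \<cdot> i"
      using comp_square[OF w(2) wh h1(1) h(1) t(1) u] wu Comp_assoc[OF ii v h1(1)] by simp
    have tq: "t' \<cdot> (q \<cdot> u) = (q1 \<cdot> v) \<cdot> i"
      using comp_square[OF w(3) wh h1(2) h(2) t(2) u] wu Comp_assoc[OF ii v h1(2)] by simp
    have "e \<cdot> (f \<cdot> (p \<cdot> u)) = f1 \<cdot> ((p1 \<cdot> v) \<cdot> i)"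
      using comp_square[OF te(1) t(1) h1(3) h(3) t(3) pu] tp by simp
    also have "\<dots> = (f1 \<cdot> (p1 \<cdot> v)) \<cdot> i" using Comp_assoc[OF ii pv h1(3)] by simp
    finally obtain x where x: "x \<in> hom C l c" "x \<cdot> i = f \<cdot> (p \<cdot> u)" "e \<cdot> x = f1 \<cdot> (p1 \<cdot> v)"
      using has_liftingD[OF i(2) ii t(3) Comp_hom[OF pu h(3)] Comp_hom[OF pv h1(3)]] by blast
    obtain y where y: "y \<in> hom C l b" "y \<cdot> i = p \<cdot> u" "t \<cdot> y = p1 \<cdot> v" "f \<cdot> y = x"
      using gap_liftingD[OF i(3) ii t(1) h1(3) t(3) pu pv x(1) x(3)[symmetric] tp x(2)[symmetric]] by blast
    have gx: "g1 \<cdot> (q1 \<cdot> v) = e \<cdot> x" "g \<cdot> (q \<cdot> u) = x \<cdot> i"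
      using comp_square[OF eq1 h1(1,3,2,4) v] comp_square[OF eq h(1,3,2,4) u] x by simp_all
    obtain y' where y': "y' \<in> hom C l b'" "y' \<cdot> i = q \<cdot> u" "t' \<cdot> y' = q1 \<cdot> v" "g \<cdot> y' = x"
      using gap_liftingD[OF i(4) ii t(2) h1(4) t(3) qu qv x(1) gx(1) tq gx(2)] by blast
    have "f \<cdot> y = g \<cdot> y'" using y y' by simp
    then obtain z where z: "z \<in> hom C l a" "p \<cdot> z = y" "q \<cdot> z = y'"
      using is_pullback_induced[OF P h(1,3,4) y(1) y'(1)] by blast
    have "z \<cdot> i = u"
      using is_pullback_unique[OF P h(1) Comp_hom[OF ii z(1)] u]
        Comp_assoc[OF ii z(1) h(1)] Comp_assoc[OF ii z(1) h(2)] z y y' by simp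
    moreover have "w \<cdot> z = v"
      using is_pullback_unique[OF P1 h1(1) Comp_hom[OF z(1) wh] v]
        comp_square[OF w(2) wh h1(1) h(1) t(1) z(1)] comp_square[OF w(3) wh h1(2) h(2) t(2) z(1)] z y y'
      by simp
    ultimately show "\<exists>h\<in>hom C l a. h \<cdot> i = u \<and> w \<cdot> h = v" using z by blast
  qed
qed

end

section \<open>Homotopy cartesian squares in a model category\<close>

context model_category
begin

section \<open>Weak equivalences and fibrations recognized by lifting\<close>

lemma Weq_arr: "f \<in> Weq M \<Longrightarrow> f \<in> Arr M"
  and Fib_arr: "f \<in> Fib M \<Longrightarrow> f \<in> Arr M"
  and Cof_arr: "f \<in> Cof M \<Longrightarrow> f \<in> Arr M"
  using Weq_wide Fib_wide Cof_wide unfolding wide_subcategory_def by blast+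

lemma Fib_comp: "f \<in> Fib M \<Longrightarrow> g \<in> Fib M \<Longrightarrow> Cod M f = Dom M g \<Longrightarrow> g \<cdot> f \<in> Fib M"
  and Ident_Fib: "a \<in> Obj M \<Longrightarrow> Ident M a \<in> Fib M"
  using Fib_wide unfolding wide_subcategory_def by blast+

lemma Ident_Weq: "a \<in> Obj M \<Longrightarrow> Ident M a \<in> Weq M"
  using Weq_wide unfolding wide_subcategory_def by blast

lemma Weq_cancel_left:
  "f \<in> hom M a b \<Longrightarrow> g \<in> hom M b c \<Longrightarrow> g \<in> Weq M \<Longrightarrow> g \<cdot> f \<in> Weq M \<longleftrightarrow> f \<in> Weq M"
  using two_of_three[of f g] unfolding hom_iff by metis

lemma Weq_cancel_right:
  "f \<in> hom M a b \<Longrightarrow> g \<in> hom M b c \<Longrightarrow> f \<in> Weq M \<Longrightarrow> g \<cdot> f \<in> Weq M \<longleftrightarrow> g \<in> Weq M"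
  using two_of_three[of f g] unfolding hom_iff by metis

text \<open>The lift \<open>r\<close> retracts \<open>c\<close> onto \<open>a\<close> over
  \<open>b\<close>. With the closure of fibrations and weak equivalences under retracts this
  converts lifting properties into membership in these classes.\<close>

lemma retract_argument:
  assumes i: "i \<in> hom M a c" and p: "p \<in> hom M c b" and L: "has_lifting M i (p \<cdot> i)"
  shows "is_retract M (p \<cdot> i) p"
proof -
  have pi: "p \<cdot> i \<in> hom M a b" using Comp_hom i p .
  have ob: "a \<in> Obj M" "b \<in> Obj M" using hom_Obj[OF pi] by auto
  obtain r where r: "r \<in> hom M c a" "r \<cdot> i = Ident M a" "(p \<cdot> i) \<cdot> r = p"
    using has_liftingD[OF L i pi Ident_hom[OF ob(1)] p] Comp_Ident[OF pi] by auto
  have eq: "Dom M (p \<cdot> i) = a" "Cod M (p \<cdot> i) = b" "Dom M p = c" "Cod M p = b"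
    using pi p by (auto simp: hom_iff)
  show ?thesis
    unfolding is_retract_def eq
  proof (intro conjI exI)
    show "p \<cdot> i \<in> Arr M" "p \<in> Arr M" using pi p by (auto simp: hom_iff)
    show "i \<in> hom M a c" "r \<in> hom M c a" "Ident M b \<in> hom M b b"
      "Ident M b \<in> hom M b b" "r \<cdot> i = Ident M a"
      by (fact i r Ident_hom[OF ob(2)])+
    show "Ident M b \<cdot> Ident M b = Ident M b" by (rule Comp_Ident[OF Ident_hom[OF ob(2)]])
    show "p \<cdot> i = Ident M b \<cdot> (p \<cdot> i)" by (rule Ident_Comp[OF pi, symmetric])
    show "(p \<cdot> i) \<cdot> r = Ident M b \<cdot> p" using Ident_Comp[OF p] r(3) by simp
  qed
qed

text \<open>In a factorization of \<open>f\<close> into an acyclic cofibration and a fibration, the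
  first factor lifts against \<open>f\<close>, so \<open>f\<close> is a retract of the
  second.\<close>

lemma FibI:
  assumes f: "f \<in> Arr M" and L: "\<And>i. i \<in> Cof M \<inter> Weq M \<Longrightarrow> has_lifting M i f"
  shows "f \<in> Fib M"
proof -
  obtain i p where i: "i \<in> Cof M \<inter> Weq M" "p \<in> Fib M" "Cod M i = Dom M p" "p \<cdot> i = f"
    using factor_acyclic_Cof_Fib[OF f] by blast
  then have "is_retract M (p \<cdot> i) p"
    using L[of i] by (intro retract_argument) (auto simp: hom_iff Cof_arr Fib_arr)
  then show ?thesis using Fib_retract i by blast
qed

lemma acyclic_FibI:
  assumes f: "f \<in> Arr M" and L: "\<And>i. i \<in> Cof M \<Longrightarrow> has_lifting M i f"
  shows "f \<in> Fib M \<inter> Weq M"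
proof -
  obtain i p where i: "i \<in> Cof M" "p \<in> Fib M \<inter> Weq M" "Cod M i = Dom M p" "p \<cdot> i = f"
    using factor_Cof_acyclic_Fib[OF f] by blast
  then have "is_retract M (p \<cdot> i) p"
    using L[of i] by (intro retract_argument) (auto simp: hom_iff Cof_arr Fib_arr)
  then show ?thesis using Fib_retract Weq_retract i by blast
qed

lemma is_pullback_square: "is_pullback M p q f g \<Longrightarrow> commutative_square M p q f g"
  by (simp add: is_pullback_def)

lemma is_pullback_arr: "is_pullback M p q f g \<Longrightarrow> q \<in> Arr M"
  by (simp add: is_pullback_def commutative_square_def)

lemma pullback_Fib:
  assumes P: "is_pullback M p q f g" and f: "f \<in> Fib M"
  shows "q \<in> Fib M"
  using FibI[OF is_pullback_arr[OF P]] has_lifting_pullback[OF P] lift_acyclic_Cof[OF _ f] Cof_arr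
  by blast

lemma pullback_acyclic_Fib:
  assumes P: "is_pullback M p q f g" and f: "f \<in> Fib M \<inter> Weq M"
  shows "q \<in> Fib M \<inter> Weq M"
  using acyclic_FibI[OF is_pullback_arr[OF P]] has_lifting_pullback[OF P] lift_Cof[OF _ f] Cof_arr
  by blast

text \<open>By \<open>L\<close> the gap map \<open>w\<close> is a fibration. The projection
  \<open>r\<close> is a base change of the acyclic fibration \<open>g\<close>, and
  \<open>r \<cdot> w = p\<close> is a weak equivalence, so \<open>w\<close> is acyclic as well and
  lifts against all cofibrations.\<close>

lemma gap_lifting_Cof:
  assumes sq: "commutative_square M p q f g" and g: "g \<in> Fib M \<inter> Weq M" and p: "p \<in> Weq M"
    and L: "\<And>i. i \<in> Cof M \<inter> Weq M \<Longrightarrow> gap_lifting M i p q f g" and i: "i \<in> Cof M"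
  shows "gap_lifting M i p q f g"
proof -
  obtain a b b' e where h: "p \<in> hom M a b" "q \<in> hom M a b'" "f \<in> hom M b e" "g \<in> hom M b' e"
    and eq: "f \<cdot> p = g \<cdot> q"
    using sq by (rule commutative_squareE)
  obtain r s where P: "is_pullback M r s f g"
    using pullback_exists[OF finite_limits h(3,4)] .
  have r: "r \<in> hom M (Dom M r) b" using P h by (simp add: is_pullback_def commutative_square_def hom_iff)
  obtain w where w: "w \<in> hom M a (Dom M r)" "r \<cdot> w = p" "s \<cdot> w = q"
    using is_pullback_induced[OF P r h(3,4,1,2) eq] by blast
  have "r \<in> Weq M"
    using pullback_acyclic_Fib[OF _ g, of s r f] P is_pullback_sym by blast
  then have "w \<in> Weq M" using Weq_cancel_left[OF w(1) r] w p by simp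
  moreover have "w \<in> Fib M"
  proof (rule FibI)
    show "w \<in> Arr M" using w by (simp add: hom_iff)
    show "has_lifting M i w" if "i \<in> Cof M \<inter> Weq M" for i
      using gap_lifting_iff[OF P w(1), of i] L[OF that] that Cof_arr w by auto
  qed
  ultimately show ?thesis
    using gap_lifting_iff[OF P w(1), of i] lift_Cof[OF i] i Cof_arr w by auto
qed

section \<open>Fibrant objects\<close>

lemma is_terminal_eq:
  assumes "is_terminal M t" "f \<in> hom M a t" "g \<in> hom M a t"
  shows "f = g"
  using assms(1) hom_Obj(1)[OF assms(2)] assms(2,3) unfolding is_terminal_def by blast

lemma is_terminal_obtain:
  assumes "is_terminal M t" "a \<in> Obj M"
  obtains f where "f \<in> hom M a t"
  using assms unfolding is_terminal_def by blast

lemma fibrant_extend: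
  assumes a: "fibrant M a" and i: "i \<in> Cof M \<inter> Weq M" "i \<in> hom M k l" and u: "u \<in> hom M k a"
  obtains v where "v \<in> hom M l a" "v \<cdot> i = u"
proof -
  obtain t f where t: "is_terminal M t" "f \<in> hom M a t" "f \<in> Fib M"
    using a unfolding fibrant_def by blast
  have "l \<in> Obj M" using hom_Obj(2)[OF i(2)] .
  then obtain v where v: "v \<in> hom M l t" using is_terminal_obtain[OF t(1)] by blast
  have "f \<cdot> u = v \<cdot> i"
    using is_terminal_eq[OF t(1) Comp_hom[OF u t(2)] Comp_hom[OF i(2) v]] .
  then show ?thesis
    using has_liftingD[OF lift_acyclic_Cof[OF i(1) t(3)] i(2) t(2) u v] that by blast
qed

text \<open>The definition of \<open>fibrant\<close> provides some terminal object only. Extension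
  along acyclic cofibrations does not mention it, and so carries the property over to any other
  terminal object.\<close>

lemma fibrant_Fib:
  assumes a: "fibrant M a" and t: "is_terminal M t" "f \<in> hom M a t"
  shows "f \<in> Fib M"
proof (rule FibI)
  show "f \<in> Arr M" using t by (simp add: hom_iff)
  fix i assume i: "i \<in> Cof M \<inter> Weq M"
  then have ii: "i \<in> hom M (Dom M i) (Cod M i)" by (simp add: hom_iff Cof_arr)
  show "has_lifting M i f"
  proof (rule has_liftingI[OF ii t(2)])
    fix u v assume u: "u \<in> hom M (Dom M i) a" and v: "v \<in> hom M (Cod M i) t"
    obtain h where h: "h \<in> hom M (Cod M i) a" "h \<cdot> i = u" using fibrant_extend[OF a i ii u] .
    then show "\<exists>h\<in>hom M (Cod M i) a. h \<cdot> i = u \<and> f \<cdot> h = v"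
      using is_terminal_eq[OF t(1) Comp_hom[OF h(1) t(2)] v] by blast
  qed
qed

lemma fibrant_dom:
  assumes f: "f \<in> hom M a b" "f \<in> Fib M" and b: "fibrant M b"
  shows "fibrant M a"
proof -
  obtain t g where t: "is_terminal M t" "g \<in> hom M b t" "g \<in> Fib M"
    using b unfolding fibrant_def by blast
  then have "g \<cdot> f \<in> hom M a t" "g \<cdot> f \<in> Fib M"
    using Comp_hom[OF f(1) t(2)] Fib_comp[OF f(2) t(3)] f t by (auto simp: hom_iff)
  then show ?thesis using t unfolding fibrant_def by blast
qed

section \<open>Fibrant replacements of cospans and their comparison\<close>

lemma factor_Weq_Fib:
  assumes "f \<in> hom M a b"
  obtains c i p where "i \<in> hom M a c" "p \<in> hom M c b" "i \<in> Weq M" "p \<in> Fib M" "p \<cdot> i = f"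
proof -
  have f: "f \<in> Arr M" "Dom M f = a" "Cod M f = b" using assms by (simp_all add: hom_iff)
  obtain i p where i: "i \<in> Cof M \<inter> Weq M" "p \<in> Fib M" "Dom M i = Dom M f" "Cod M i = Dom M p" "Cod M p = Cod M f"
    "p \<cdot> i = f"
    using factor_acyclic_Cof_Fib[OF f(1)] by blast
  show ?thesis
    by (rule that[of i "Dom M p" p]) (use i f Fib_arr[OF i(2)] Weq_arr[of i] in \<open>simp_all add: hom_iff\<close>)
qed

lemma fibrant_replacement:
  assumes "a \<in> Obj M"
  obtains i c where "i \<in> hom M a c" "i \<in> Weq M" "fibrant M c"
proof -
  obtain t where t: "is_terminal M t" using terminal_exists[OF finite_limits] .
  obtain f where f: "f \<in> hom M a t" using is_terminal_obtain[OF t assms] .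
  obtain c i p where i: "i \<in> hom M a c" "p \<in> hom M c t" "i \<in> Weq M" "p \<in> Fib M" "p \<cdot> i = f"
    using factor_Weq_Fib[OF f] .
  then have "fibrant M c" using t unfolding fibrant_def by blast
  then show ?thesis using that i(1,3) by blast
qed

text \<open>The product of \<open>c1\<close> and \<open>c2\<close> is formed as a pullback over a
  terminal object; its projections are fibrations because both factors are fibrant. The map from
  \<open>c\<close> to the product is factored into a weak equivalence and a fibration, and
  two-of-three makes \<open>r1\<close> and \<open>r2\<close> acyclic.\<close>

lemma common_fibrant_replacement:
  assumes e1: "e1 \<in> hom M c c1" "e1 \<in> Weq M" "fibrant M c1"
    and e2: "e2 \<in> hom M c c2" "e2 \<in> Weq M" "fibrant M c2"
  obtains d e r1 r2 where "e \<in> hom M c d" "r1 \<in> hom M d c1" "r2 \<in> hom M d c2"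
    "r1 \<in> Fib M \<inter> Weq M" "r2 \<in> Fib M \<inter> Weq M" "r1 \<cdot> e = e1" "r2 \<cdot> e = e2"
proof -
  obtain t where t: "is_terminal M t" using terminal_exists[OF finite_limits] .
  obtain t1 where t1: "t1 \<in> hom M c1 t" using is_terminal_obtain[OF t hom_Obj(2)[OF e1(1)]] .
  obtain t2 where t2: "t2 \<in> hom M c2 t" using is_terminal_obtain[OF t hom_Obj(2)[OF e2(1)]] .
  note t12 = t1 t2
  have F: "t1 \<in> Fib M" "t2 \<in> Fib M" using fibrant_Fib[OF e1(3) t t12(1)] fibrant_Fib[OF e2(3) t t12(2)] .
  obtain p q where P: "is_pullback M p q t1 t2" using pullback_exists[OF finite_limits t12] .
  have pq: "p \<in> hom M (Dom M p) c1" "q \<in> hom M (Dom M p) c2"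
    using is_pullback_square[OF P] t12 by (auto simp: commutative_square_def hom_iff)
  have pqF: "p \<in> Fib M" "q \<in> Fib M"
    using pullback_Fib[OF P[unfolded is_pullback_sym[of p q]] F(2)] pullback_Fib[OF P F(1)] .
  have "t1 \<cdot> e1 = t2 \<cdot> e2" using is_terminal_eq[OF t Comp_hom[OF e1(1) t12(1)] Comp_hom[OF e2(1) t12(2)]] .
  then obtain h where h: "h \<in> hom M c (Dom M p)" "p \<cdot> h = e1" "q \<cdot> h = e2"
    using is_pullback_induced[OF P pq(1) t12 e1(1) e2(1)] by blast
  obtain d i r where i: "i \<in> hom M c d" "r \<in> hom M d (Dom M p)" "i \<in> Weq M" "r \<in> Fib M" "r \<cdot> i = h"
    using factor_Weq_Fib[OF h(1)] .
  have 1: "(p \<cdot> r) \<cdot> i = e1" "(q \<cdot> r) \<cdot> i = e2"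
    using Comp_assoc[OF i(1,2)] pq i h by auto
  have pr: "p \<cdot> r \<in> hom M d c1" "q \<cdot> r \<in> hom M d c2" using Comp_hom[OF i(2) pq(1)] Comp_hom[OF i(2) pq(2)] .
  have "p \<cdot> r \<in> Fib M" "q \<cdot> r \<in> Fib M" using Fib_comp[OF i(4) pqF(1)] Fib_comp[OF i(4) pqF(2)] i(2) pq by (simp_all add: hom_iff)
  moreover have "p \<cdot> r \<in> Weq M" "q \<cdot> r \<in> Weq M"
    using Weq_cancel_right[OF i(1) pr(1) i(3)] Weq_cancel_right[OF i(1) pr(2) i(3)] 1 e1 e2 by auto
  ultimately show ?thesis using that[OF i(1) pr] 1 by blast
qed

text \<open>The hypothesis \<open>lift\<close> says that \<open>b\<close> lifts against acyclic
  cofibrations jointly over both legs. A problem that mentions only the first leg is completed by a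
  component \<open>y2\<close>, obtained by lifting along the fibration \<open>f2\<close>;
  \<open>gap_lifting_Cof\<close> then passes to all cofibrations.\<close>

lemma gap_lifting_leg:
  assumes h: "s1 \<in> hom M b b1" "s2 \<in> hom M b b2" "f \<in> hom M b c" "f1 \<in> hom M b1 c1" "f2 \<in> hom M b2 c2"
      "r1 \<in> hom M c c1" "r2 \<in> hom M c c2"
    and sq: "f1 \<cdot> s1 = r1 \<cdot> f" "f2 \<cdot> s2 = r2 \<cdot> f"
    and r1: "r1 \<in> Fib M \<inter> Weq M" and s1: "s1 \<in> Weq M" and f2: "f2 \<in> Fib M"
    and lift: "\<And>j k l u x y1 y2. j \<in> Cof M \<inter> Weq M \<Longrightarrow> j \<in> hom M k l \<Longrightarrow> u \<in> hom M k b \<Longrightarrow>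
      x \<in> hom M l c \<Longrightarrow> y1 \<in> hom M l b1 \<Longrightarrow> y2 \<in> hom M l b2 \<Longrightarrow> f1 \<cdot> y1 = r1 \<cdot> x \<Longrightarrow> f2 \<cdot> y2 = r2 \<cdot> x \<Longrightarrow>
      f \<cdot> u = x \<cdot> j \<Longrightarrow> s1 \<cdot> u = y1 \<cdot> j \<Longrightarrow> s2 \<cdot> u = y2 \<cdot> j \<Longrightarrow>
      \<exists>h\<in>hom M l b. h \<cdot> j = u \<and> f \<cdot> h = x \<and> s1 \<cdot> h = y1 \<and> s2 \<cdot> h = y2"
    and i: "i \<in> Cof M"
  shows "gap_lifting M i s1 f f1 r1"
proof (rule gap_lifting_Cof[OF _ r1 s1 _ i])
  show "commutative_square M s1 f f1 r1" by (rule commutative_squareI[OF h(1,3,4,6) sq(1)])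
  fix j assume j: "j \<in> Cof M \<inter> Weq M"
  then have jj: "j \<in> hom M (Dom M j) (Cod M j)" by (simp add: hom_iff Cof_arr)
  show "gap_lifting M j s1 f f1 r1"
  proof (rule gap_liftingI[OF jj h(1,4,6)])
    fix u y x assume u: "u \<in> hom M (Dom M j) b" and y: "y \<in> hom M (Cod M j) b1" and x: "x \<in> hom M (Cod M j) c"
      and e: "f1 \<cdot> y = r1 \<cdot> x" "s1 \<cdot> u = y \<cdot> j" "f \<cdot> u = x \<cdot> j"
    have "f2 \<cdot> (s2 \<cdot> u) = (r2 \<cdot> x) \<cdot> j"
      using comp_square[OF sq(2) h(2,5,3,7) u] e Comp_assoc[OF jj x h(7)] by simp
    then obtain y2 where y2: "y2 \<in> hom M (Cod M j) b2" "y2 \<cdot> j = s2 \<cdot> u" "f2 \<cdot> y2 = r2 \<cdot> x"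
      using has_liftingD[OF lift_acyclic_Cof[OF j f2] jj h(5) Comp_hom[OF u h(2)] Comp_hom[OF x h(7)]] by blast
    then show "\<exists>h\<in>hom M (Cod M j) b. h \<cdot> j = u \<and> s1 \<cdot> h = y \<and> f \<cdot> h = x"
      using lift[OF j jj u x y y2(1) e(1) y2(3) e(3) e(2) y2(2)[symmetric]] by blast
  qed
qed

text \<open>\<open>d\<close> is obtained by factoring the map from \<open>b\<close> to the limit of \<open>b1 \<rightarrow> c1 \<leftarrow> c \<rightarrow> c2 \<leftarrow> b2\<close>.\<close>

lemma common_leg:
  assumes h: "f \<in> hom M b c" "r1 \<in> hom M c c1" "r2 \<in> hom M c c2" "f1 \<in> hom M b1 c1" "f2 \<in> hom M b2 c2"
      "t1 \<in> hom M b b1" "t2 \<in> hom M b b2"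
    and sq: "f1 \<cdot> t1 = r1 \<cdot> f" "f2 \<cdot> t2 = r2 \<cdot> f"
    and r: "r1 \<in> Fib M \<inter> Weq M" "r2 \<in> Fib M \<inter> Weq M"
    and F: "f1 \<in> Fib M" "f2 \<in> Fib M" and W: "t1 \<in> Weq M" "t2 \<in> Weq M"
  obtains d t f' s1 s2 where "t \<in> hom M b d" "f' \<in> hom M d c" "f' \<cdot> t = f"
    "commutative_square M s1 f' f1 r1" "commutative_square M s2 f' f2 r2"
    "s1 \<cdot> t = t1" "s2 \<cdot> t = t2"
    "\<And>i. i \<in> Cof M \<Longrightarrow> gap_lifting M i s1 f' f1 r1" "\<And>i. i \<in> Cof M \<Longrightarrow> gap_lifting M i s2 f' f2 r2"
proof -
  \<comment> \<open>\<open>P0\<close> is the fibre product of \<open>b1\<close> and \<open>c\<close>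
    over \<open>c1\<close>, and a second pullback, with \<open>b2\<close> over \<open>c2\<close>,
    gives the limit \<open>T0\<close> of the zigzag. The facts \<open>ind\<close> and
    \<open>uni\<close> below are its universal property.\<close>
  obtain p q where P: "is_pullback M p q f1 r1" using pullback_exists[OF finite_limits h(4,2)] .
  define P0 where "P0 = Dom M p"
  have pq: "p \<in> hom M P0 b1" "q \<in> hom M P0 c" "f1 \<cdot> p = r1 \<cdot> q"
    using is_pullback_square[OF P] h by (auto simp: commutative_square_def hom_iff P0_def)
  obtain z2 z1 where T: "is_pullback M z2 z1 f2 (r2 \<cdot> q)"
    using pullback_exists[OF finite_limits h(5) Comp_hom[OF pq(2) h(3)]] .
  define T0 where "T0 = Dom M z2"
  have z: "z2 \<in> hom M T0 b2" "z1 \<in> hom M T0 P0" "f2 \<cdot> z2 = (r2 \<cdot> q) \<cdot> z1"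
    using is_pullback_square[OF T] h pq by (auto simp: commutative_square_def hom_iff T0_def)
  have zx: "q \<cdot> z1 \<in> hom M T0 c" and zy: "p \<cdot> z1 \<in> hom M T0 b1" using Comp_hom[OF z(2) pq(2)] Comp_hom[OF z(2) pq(1)] .
  have Tsq: "f1 \<cdot> (p \<cdot> z1) = r1 \<cdot> (q \<cdot> z1)" "f2 \<cdot> z2 = r2 \<cdot> (q \<cdot> z1)"
    using comp_square[OF pq(3,1) h(4) pq(2) h(2) z(2)] z(3) Comp_assoc[OF z(2) pq(2) h(3)] by auto
  have ind: "\<exists>w\<in>hom M l T0. (q \<cdot> z1) \<cdot> w = x \<and> (p \<cdot> z1) \<cdot> w = y1 \<and> z2 \<cdot> w = y2"
    if x: "x \<in> hom M l c" "y1 \<in> hom M l b1" "y2 \<in> hom M l b2" "f1 \<cdot> y1 = r1 \<cdot> x" "f2 \<cdot> y2 = r2 \<cdot> x" for l x y1 y2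
  proof -
    obtain v where v: "v \<in> hom M l P0" "p \<cdot> v = y1" "q \<cdot> v = x"
      using is_pullback_induced[OF P pq(1) h(4,2) x(2,1,4)] by blast
    have "f2 \<cdot> y2 = (r2 \<cdot> q) \<cdot> v" using x v Comp_assoc[OF v(1) pq(2) h(3)] by simp
    then obtain w where w: "w \<in> hom M l T0" "z2 \<cdot> w = y2" "z1 \<cdot> w = v"
      using is_pullback_induced[OF T z(1) h(5) Comp_hom[OF pq(2) h(3)] x(3) v(1)] by blast
    then show ?thesis using v Comp_assoc[OF w(1) z(2)] pq by auto
  qed
  have uni: "w = w'" if w: "w \<in> hom M l T0" "w' \<in> hom M l T0" "(q \<cdot> z1) \<cdot> w = (q \<cdot> z1) \<cdot> w'"
      "(p \<cdot> z1) \<cdot> w = (p \<cdot> z1) \<cdot> w'" "z2 \<cdot> w = z2 \<cdot> w'" for l w w'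
  proof -
    have "z1 \<cdot> w = z1 \<cdot> w'"
      using is_pullback_unique[OF P pq(1) Comp_hom[OF w(1) z(2)] Comp_hom[OF w(2) z(2)]] w(3,4)
        Comp_assoc[OF w(1) z(2)] Comp_assoc[OF w(2) z(2)] pq by simp
    then show ?thesis using is_pullback_unique[OF T z(1) w(1,2)] w(5) by blast
  qed
  obtain v where v: "v \<in> hom M b T0" "(q \<cdot> z1) \<cdot> v = f" "(p \<cdot> z1) \<cdot> v = t1" "z2 \<cdot> v = t2"
    using ind[OF h(1,6,7)] sq by blast
  obtain d t s where t: "t \<in> hom M b d" "s \<in> hom M d T0" "t \<in> Weq M" "s \<in> Fib M" "s \<cdot> t = v"
    using factor_Weq_Fib[OF v(1)] .
  define f' s1 s2 where "f' = (q \<cdot> z1) \<cdot> s" and "s1 = (p \<cdot> z1) \<cdot> s" and "s2 = z2 \<cdot> s"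
  have hom': "f' \<in> hom M d c" "s1 \<in> hom M d b1" "s2 \<in> hom M d b2"
    unfolding f'_def s1_def s2_def using Comp_hom[OF t(2) zx] Comp_hom[OF t(2) zy] Comp_hom[OF t(2) z(1)] .
  have sq': "f1 \<cdot> s1 = r1 \<cdot> f'" "f2 \<cdot> s2 = r2 \<cdot> f'"
    unfolding f'_def s1_def s2_def
    using comp_square[OF Tsq(1) zy h(4) zx h(2) t(2)] comp_square[OF Tsq(2) z(1) h(5) zx h(3) t(2)] by auto
  have tri: "f' \<cdot> t = f" "s1 \<cdot> t = t1" "s2 \<cdot> t = t2"
    unfolding f'_def s1_def s2_def using Comp_assoc[OF t(1,2)] zx zy z v t by auto
  have sW: "s1 \<in> Weq M" "s2 \<in> Weq M"
    using Weq_cancel_right[OF t(1) hom'(2) t(3)] Weq_cancel_right[OF t(1) hom'(3) t(3)] tri W by auto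
  \<comment> \<open>A compatible triple \<open>x\<close>, \<open>y1\<close>, \<open>y2\<close> is a
    single map to \<open>T0\<close>, so this is lifting against the fibration
    \<open>s\<close>.\<close>
  have lift: "\<exists>h\<in>hom M l d. h \<cdot> j = u \<and> f' \<cdot> h = x \<and> s1 \<cdot> h = y1 \<and> s2 \<cdot> h = y2"
    if j: "j \<in> Cof M \<inter> Weq M" "j \<in> hom M k l" and u: "u \<in> hom M k d"
      and x: "x \<in> hom M l c" "y1 \<in> hom M l b1" "y2 \<in> hom M l b2" "f1 \<cdot> y1 = r1 \<cdot> x" "f2 \<cdot> y2 = r2 \<cdot> x"
      and e: "f' \<cdot> u = x \<cdot> j" "s1 \<cdot> u = y1 \<cdot> j" "s2 \<cdot> u = y2 \<cdot> j" for j k l u x y1 y2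
  proof -
    obtain w where w: "w \<in> hom M l T0" "(q \<cdot> z1) \<cdot> w = x" "(p \<cdot> z1) \<cdot> w = y1" "z2 \<cdot> w = y2"
      using ind[OF x] by blast
    have "s \<cdot> u = w \<cdot> j"
      using uni[OF Comp_hom[OF u t(2)] Comp_hom[OF j(2) w(1)]] e w
        Comp_assoc[OF u t(2)] Comp_assoc[OF j(2) w(1)] zx zy z unfolding f'_def s1_def s2_def by auto
    then obtain h where h: "h \<in> hom M l d" "h \<cdot> j = u" "s \<cdot> h = w"
      using has_liftingD[OF lift_acyclic_Cof[OF j(1) t(4)] j(2) t(2) u w(1)] by blast
    then show ?thesis
      using Comp_assoc[OF h(1) t(2)] zx zy z w unfolding f'_def s1_def s2_def by auto
  qed
  show ?thesis
  proof (rule that[OF t(1) hom'(1) tri(1) _ _ tri(2,3)])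
    show "commutative_square M s1 f' f1 r1" by (rule commutative_squareI[OF hom'(2,1) h(4,2) sq'(1)])
    show "commutative_square M s2 f' f2 r2" by (rule commutative_squareI[OF hom'(3,1) h(5,3) sq'(2)])
    show "gap_lifting M i s1 f' f1 r1" if "i \<in> Cof M" for i
      using gap_lifting_leg[OF hom'(2,3,1) h(4,5,2,3) sq' r(1) sW(1) F(2) _ that] lift by blast
    show "gap_lifting M i s2 f' f2 r2" if "i \<in> Cof M" for i
    proof (rule gap_lifting_leg[OF hom'(3,2,1) h(5,4,3,2) sq'(2,1) r(2) sW(2) F(1) _ that])
      fix j k l u x y1 y2
      assume "j \<in> Cof M \<inter> Weq M" "j \<in> hom M k l" "u \<in> hom M k d" "x \<in> hom M l c" "y1 \<in> hom M l b2"
        "y2 \<in> hom M l b1" "f2 \<cdot> y1 = r2 \<cdot> x" "f1 \<cdot> y2 = r1 \<cdot> x" "f' \<cdot> u = x \<cdot> j" "s2 \<cdot> u = y1 \<cdot> j" "s1 \<cdot> u = y2 \<cdot> j"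
      then show "\<exists>h\<in>hom M l d. h \<cdot> j = u \<and> f' \<cdot> h = x \<and> s2 \<cdot> h = y1 \<and> s1 \<cdot> h = y2"
        using lift[of j k l u x y2 y1] by blast
    qed
  qed
qed

text \<open>The induced map \<open>w\<close> of pullbacks is an acyclic fibration by
  \<open>has_lifting_pullback_map\<close>, and \<open>w \<cdot> u = u1\<close>, so two-of-three
  applies.\<close>

lemma pullback_gap_Weq_iff:
  assumes P: "is_pullback M p q f g" and P1: "is_pullback M p1 q1 f1 g1"
    and sq: "commutative_square M t f f1 e" "commutative_square M t' g g1 e"
    and e: "e \<in> Fib M \<inter> Weq M"
    and gap: "\<And>i. i \<in> Cof M \<Longrightarrow> gap_lifting M i t f f1 e" "\<And>i. i \<in> Cof M \<Longrightarrow> gap_lifting M i t' g g1 e"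
    and u: "u \<in> hom M a (Dom M p)" and u1: "u1 \<in> hom M a (Dom M p1)"
    and eq: "p1 \<cdot> u1 = t \<cdot> (p \<cdot> u)" "q1 \<cdot> u1 = t' \<cdot> (q \<cdot> u)"
  shows "u1 \<in> Weq M \<longleftrightarrow> u \<in> Weq M"
proof -
  obtain P0 b b' c where h: "p \<in> hom M P0 b" "q \<in> hom M P0 b'" "f \<in> hom M b c" "g \<in> hom M b' c"
    and pe: "f \<cdot> p = g \<cdot> q"
    using P by (rule is_pullback_homE)
  obtain Q0 b1 b1' c1 where h1: "p1 \<in> hom M Q0 b1" "q1 \<in> hom M Q0 b1'" "f1 \<in> hom M b1 c1" "g1 \<in> hom M b1' c1"
    using P1 by (rule is_pullback_homE)
  have t: "t \<in> hom M b b1" "t' \<in> hom M b' b1'" "e \<in> hom M c c1"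
    and te: "f1 \<cdot> t = e \<cdot> f" "g1 \<cdot> t' = e \<cdot> g"
    using sq h h1 by (auto simp: commutative_square_def hom_iff)
  have dom: "Dom M p = P0" "Dom M p1 = Q0" using h h1 by (simp_all add: hom_iff)
  note u' = u[unfolded dom] and u1' = u1[unfolded dom]
  have "f1 \<cdot> (t \<cdot> p) = e \<cdot> (f \<cdot> p)" by (rule comp_square[OF te(1) t(1) h1(3) h(3) t(3) h(1)])
  also have "\<dots> = g1 \<cdot> (t' \<cdot> q)" using comp_square[OF te(2) t(2) h1(4) h(4) t(3) h(2)] pe by simp
  finally obtain w where w: "w \<in> hom M P0 Q0" "p1 \<cdot> w = t \<cdot> p" "q1 \<cdot> w = t' \<cdot> q"
    using is_pullback_induced[OF P1 h1(1,3,4) Comp_hom[OF h(1) t(1)] Comp_hom[OF h(2) t(2)]] by blast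
  have "w \<in> Weq M"
  proof -
    have "has_lifting M i w" if i: "i \<in> Cof M" for i
      by (rule has_lifting_pullback_map[OF P P1 sq w(1)[folded dom] w(2,3) Cof_arr[OF i] lift_Cof[OF i e] gap(1)[OF i] gap(2)[OF i]])
    moreover have "w \<in> Arr M" using w(1) by (simp add: hom_iff)
    ultimately show ?thesis using acyclic_FibI by blast
  qed
  moreover have "w \<cdot> u = u1"
  proof (rule is_pullback_unique[OF P1 h1(1) Comp_hom[OF u' w(1)] u1'])
    show "p1 \<cdot> (w \<cdot> u) = p1 \<cdot> u1" using comp_square[OF w(2,1) h1(1) h(1) t(1) u'] eq by simp
    show "q1 \<cdot> (w \<cdot> u) = q1 \<cdot> u1" using comp_square[OF w(3,1) h1(2) h(2) t(2) u'] eq by simp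
  qed
  ultimately show ?thesis
    using Weq_cancel_left[OF u' w(1)] by simp
qed

lemma fibrant_replacement_cospanE:
  assumes R: "fibrant_replacement_cospan M f g b b' e f' g'" and h: "f \<in> hom M x c" "g \<in> hom M x' c"
  obtains y y' d where "b \<in> hom M x y" "b' \<in> hom M x' y'" "e \<in> hom M c d" "f' \<in> hom M y d" "g' \<in> hom M y' d"
    "b \<in> Weq M" "b' \<in> Weq M" "e \<in> Weq M" "f' \<in> Fib M" "g' \<in> Fib M" "fibrant M d"
    "f' \<cdot> b = e \<cdot> f" "g' \<cdot> b' = e \<cdot> g"
  by (rule that[of "Dom M f'" "Dom M g'" "Cod M e"])
    (use R h in \<open>simp_all add: fibrant_replacement_cospan_def commutative_square_def hom_iff\<close>)

lemma fibrant_replacement_cospanI: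
  assumes "f \<in> hom M x c" "g \<in> hom M x' c" "b \<in> hom M x y" "b' \<in> hom M x' y'" "e \<in> hom M c d" "f' \<in> hom M y d" "g' \<in> hom M y' d"
    "b \<in> Weq M" "b' \<in> Weq M" "e \<in> Weq M" "f' \<in> Fib M" "g' \<in> Fib M" "fibrant M d"
    "f' \<cdot> b = e \<cdot> f" "g' \<cdot> b' = e \<cdot> g"
  shows "fibrant_replacement_cospan M f g b b' e f' g'"
  using assms by (simp add: fibrant_replacement_cospan_def commutative_square_def hom_iff)

text \<open>The dominating cospan is built at the corner \<open>c\<close> and after that in each leg
  over the new corner. Both given gap maps are compared with its gap map \<open>u3\<close>; its legs
  \<open>f3\<close> and \<open>g3\<close> enter through the lifting properties of the maps to the
  two given cospans.\<close>

lemma homotopy_pullback_gap_Weq_iff: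
  assumes sq: "commutative_square M p q f g"
    and R1: "fibrant_replacement_cospan M f g b1 b1' e1 f1 g1" and P1: "is_pullback M p1 q1 f1 g1"
    and u1: "u1 \<in> hom M (Dom M p) (Dom M p1)" "p1 \<cdot> u1 = b1 \<cdot> p" "q1 \<cdot> u1 = b1' \<cdot> q"
    and R2: "fibrant_replacement_cospan M f g b2 b2' e2 f2 g2" and P2: "is_pullback M p2 q2 f2 g2"
    and u2: "u2 \<in> hom M (Dom M p) (Dom M p2)" "p2 \<cdot> u2 = b2 \<cdot> p" "q2 \<cdot> u2 = b2' \<cdot> q"
  shows "u1 \<in> Weq M \<longleftrightarrow> u2 \<in> Weq M"
proof -
  obtain a x x' z where h: "p \<in> hom M a x" "q \<in> hom M a x'" "f \<in> hom M x z" "g \<in> hom M x' z"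
    and pe: "f \<cdot> p = g \<cdot> q"
    using sq by (rule commutative_squareE)
  obtain y1 y1' c1 where h1: "b1 \<in> hom M x y1" "b1' \<in> hom M x' y1'" "e1 \<in> hom M z c1"
      "f1 \<in> hom M y1 c1" "g1 \<in> hom M y1' c1"
    and w1: "b1 \<in> Weq M" "b1' \<in> Weq M" "e1 \<in> Weq M" "f1 \<in> Fib M" "g1 \<in> Fib M" "fibrant M c1"
    and eq1: "f1 \<cdot> b1 = e1 \<cdot> f" "g1 \<cdot> b1' = e1 \<cdot> g"
    using R1 h(3,4) by (rule fibrant_replacement_cospanE)
  obtain y2 y2' c2 where h2: "b2 \<in> hom M x y2" "b2' \<in> hom M x' y2'" "e2 \<in> hom M z c2"
      "f2 \<in> hom M y2 c2" "g2 \<in> hom M y2' c2"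
    and w2: "b2 \<in> Weq M" "b2' \<in> Weq M" "e2 \<in> Weq M" "f2 \<in> Fib M" "g2 \<in> Fib M" "fibrant M c2"
    and eq2: "f2 \<cdot> b2 = e2 \<cdot> f" "g2 \<cdot> b2' = e2 \<cdot> g"
    using R2 h(3,4) by (rule fibrant_replacement_cospanE)
  have pa: "Dom M p = a" using h by (simp add: hom_iff)
  note u1 = u1[unfolded pa] and u2 = u2[unfolded pa]
  obtain c e r1 r2 where e: "e \<in> hom M z c" "r1 \<in> hom M c c1" "r2 \<in> hom M c c2"
    "r1 \<in> Fib M \<inter> Weq M" "r2 \<in> Fib M \<inter> Weq M" "r1 \<cdot> e = e1" "r2 \<cdot> e = e2"
    using common_fibrant_replacement[OF h1(3) w1(3,6) h2(3) w2(3,6)] .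
  note ef = Comp_hom[OF h(3) e(1)] and eg = Comp_hom[OF h(4) e(1)]
  have f12: "f1 \<cdot> b1 = r1 \<cdot> (e \<cdot> f)" "f2 \<cdot> b2 = r2 \<cdot> (e \<cdot> f)"
    "g1 \<cdot> b1' = r1 \<cdot> (e \<cdot> g)" "g2 \<cdot> b2' = r2 \<cdot> (e \<cdot> g)"
    using eq1 eq2 e Comp_assoc[OF h(3) e(1)] Comp_assoc[OF h(4) e(1)] by auto
  obtain d t f3 s1 s2 where L: "t \<in> hom M x d" "f3 \<in> hom M d c" "f3 \<cdot> t = e \<cdot> f"
    "commutative_square M s1 f3 f1 r1" "commutative_square M s2 f3 f2 r2" "s1 \<cdot> t = b1" "s2 \<cdot> t = b2"
    "\<And>i. i \<in> Cof M \<Longrightarrow> gap_lifting M i s1 f3 f1 r1" "\<And>i. i \<in> Cof M \<Longrightarrow> gap_lifting M i s2 f3 f2 r2"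
    using common_leg[OF ef e(2,3) h1(4) h2(4) h1(1) h2(1) f12(1,2) e(4,5) w1(4) w2(4) w1(1) w2(1)] by metis
  obtain d' t' g3 s1' s2' where L': "t' \<in> hom M x' d'" "g3 \<in> hom M d' c" "g3 \<cdot> t' = e \<cdot> g"
    "commutative_square M s1' g3 g1 r1" "commutative_square M s2' g3 g2 r2" "s1' \<cdot> t' = b1'" "s2' \<cdot> t' = b2'"
    "\<And>i. i \<in> Cof M \<Longrightarrow> gap_lifting M i s1' g3 g1 r1" "\<And>i. i \<in> Cof M \<Longrightarrow> gap_lifting M i s2' g3 g2 r2"
    using common_leg[OF eg e(2,3) h1(5) h2(5) h1(2) h2(2) f12(3,4) e(4,5) w1(5) w2(5) w1(2) w2(2)] by metis
  obtain p3 q3 where P3: "is_pullback M p3 q3 f3 g3" using pullback_exists[OF finite_limits L(2) L'(2)] .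
  have p3: "p3 \<in> hom M (Dom M p3) d" using is_pullback_square[OF P3] L(2) by (simp add: commutative_square_def hom_iff)
  have "f3 \<cdot> (t \<cdot> p) = e \<cdot> (f \<cdot> p)" by (rule comp_square[OF L(3,1,2) h(3) e(1) h(1)])
  also have "\<dots> = g3 \<cdot> (t' \<cdot> q)" using comp_square[OF L'(3,1,2) h(4) e(1) h(2)] pe by simp
  finally obtain u3 where u3: "u3 \<in> hom M a (Dom M p3)" "p3 \<cdot> u3 = t \<cdot> p" "q3 \<cdot> u3 = t' \<cdot> q"
    using is_pullback_induced[OF P3 p3 L(2) L'(2) Comp_hom[OF h(1) L(1)] Comp_hom[OF h(2) L'(1)]] by blast
  have s: "s1 \<in> hom M d y1" "s2 \<in> hom M d y2"
    "s1' \<in> hom M d' y1'" "s2' \<in> hom M d' y2'"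
    using L(2,4,5) L'(2,4,5) h1 h2 by (auto simp: commutative_square_def hom_iff)
  have "u1 \<in> Weq M \<longleftrightarrow> u3 \<in> Weq M"
    by (rule pullback_gap_Weq_iff[OF P3 P1 L(4) L'(4) e(4) L(8) L'(8) u3(1) u1(1)])
      (use u1 u3 comp_triangle[OF L(6,1) s(1) h(1)] comp_triangle[OF L'(6,1) s(3) h(2)] in auto)
  moreover have "u2 \<in> Weq M \<longleftrightarrow> u3 \<in> Weq M"
    by (rule pullback_gap_Weq_iff[OF P3 P2 L(5) L'(5) e(5) L(9) L'(9) u3(1) u2(1)])
      (use u2 u3 comp_triangle[OF L(7,1) s(2) h(1)] comp_triangle[OF L'(7,1) s(4) h(2)] in auto)
  ultimately show ?thesis by simp
qed

text \<open>The definition asks for one good choice of homotopy pullback. This form allows each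
  later proof to test the replacement that suits it.\<close>

lemma homotopy_cartesian_iff:
  assumes "commutative_square M p q f g"
    and "fibrant_replacement_cospan M f g b b' e f' g'" and "is_pullback M p' q' f' g'"
    and "u \<in> hom M (Dom M p) (Dom M p')" "p' \<cdot> u = b \<cdot> p" "q' \<cdot> u = b' \<cdot> q"
  shows "homotopy_cartesian M p q f g \<longleftrightarrow> u \<in> Weq M"
  using assms homotopy_pullback_gap_Weq_iff[OF assms]
  unfolding homotopy_cartesian_def is_homotopy_pullback_def by blast

section \<open>Symmetry, degenerate squares and pasting\<close>

lemma homotopy_cartesian_sym: "homotopy_cartesian M p q f g \<longleftrightarrow> homotopy_cartesian M q p g f"
proof -
  have "homotopy_cartesian M q p g f" if H: "homotopy_cartesian M p q f g" for p q f g
  proof -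
    obtain b b' e f' g' p' q' u where sq: "commutative_square M p q f g"
      and R: "fibrant_replacement_cospan M f g b b' e f' g'" and P: "is_pullback M p' q' f' g'"
      and u: "u \<in> hom M (Dom M p) (Dom M p')" "p' \<cdot> u = b \<cdot> p" "q' \<cdot> u = b' \<cdot> q" "u \<in> Weq M"
      using H unfolding homotopy_cartesian_def is_homotopy_pullback_def by blast
    have sq': "commutative_square M q p g f" by (rule sq[unfolded commutative_square_sym[of p q]])
    have P': "is_pullback M q' p' g' f'" by (rule P[unfolded is_pullback_sym[of p' q']])
    obtain x x' c where h: "f \<in> hom M x c" "g \<in> hom M x' c"
      using sq by (rule commutative_squareE)
    have R': "fibrant_replacement_cospan M g f b' b e g' f'"
      using R h by (rule fibrant_replacement_cospanE) (rule fibrant_replacement_cospanI[OF h(2,1)])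
    have "Dom M p = Dom M q" "Dom M p' = Dom M q'"
      using sq is_pullback_square[OF P] by (simp_all add: commutative_square_def)
    then have "u \<in> hom M (Dom M q) (Dom M q')" using u(1) by simp
    then show ?thesis
      using homotopy_cartesian_iff[OF sq' R' P' _ u(3,2)] u(4) by blast
  qed
  then show ?thesis by blast
qed

text \<open>Since \<open>f\<close> is a weak equivalence, so is \<open>e \<cdot> f\<close>, and the
  leg \<open>f\<close> may be replaced by the identity of \<open>d\<close>. The homotopy pullback is
  then \<open>x\<close> itself, with gap map \<open>i \<cdot> q\<close>.\<close>

lemma homotopy_cartesian_Weq:
  assumes sq: "commutative_square M p q f g" and W: "q \<in> Weq M" "f \<in> Weq M"
  shows "homotopy_cartesian M p q f g"
proof -
  obtain a b b' c where h: "p \<in> hom M a b" "q \<in> hom M a b'" "f \<in> hom M b c" "g \<in> hom M b' c"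
    and eq: "f \<cdot> p = g \<cdot> q"
    using sq by (rule commutative_squareE)
  have "c \<in> Obj M" using hom_Obj(2)[OF h(3)] .
  then obtain e d where e: "e \<in> hom M c d" "e \<in> Weq M" "fibrant M d" using fibrant_replacement by blast
  have d: "d \<in> Obj M" using hom_Obj(2)[OF e(1)] .
  obtain x i r where i: "i \<in> hom M b' x" "r \<in> hom M x d" "i \<in> Weq M" "r \<in> Fib M" "r \<cdot> i = e \<cdot> g"
    using factor_Weq_Fib[OF Comp_hom[OF h(4) e(1)]] .
  have x: "x \<in> Obj M" using hom_Obj(2)[OF i(1)] .
  have ef: "e \<cdot> f \<in> hom M b d" "e \<cdot> f \<in> Weq M"
    using Comp_hom[OF h(3) e(1)] Weq_cancel_left[OF h(3) e(1)] e W by auto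
  have R: "fibrant_replacement_cospan M f g (e \<cdot> f) i e (Ident M d) r"
    by (rule fibrant_replacement_cospanI[OF h(3,4) ef(1) i(1) e(1) Ident_hom[OF d] i(2) ef(2) i(3) e(2) Ident_Fib[OF d] i(4) e(3)
          Ident_Comp[OF ef(1)] i(5)])
  have iq: "i \<cdot> q \<in> hom M a x" "i \<cdot> q \<in> Weq M"
    using Comp_hom[OF h(2) i(1)] Weq_cancel_left[OF h(2) i(1)] i W by auto
  have "r \<cdot> (i \<cdot> q) = (e \<cdot> f) \<cdot> p"
    using comp_square[OF i(5,1,2) h(4) e(1) h(2)] eq Comp_assoc[OF h(1,3) e(1)] by simp
  moreover have "Ident M x \<cdot> (i \<cdot> q) = i \<cdot> q" using iq Ident_Comp by blast
  moreover have "i \<cdot> q \<in> hom M (Dom M p) (Dom M r)" using iq h i by (simp add: hom_iff)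
  ultimately show ?thesis
    using homotopy_cartesian_iff[OF sq R is_pullback_ident[OF i(2)]] iq by simp
qed

lemma homotopy_cartesian_paste:
  assumes H: "homotopy_cartesian M p q f g" and sq: "commutative_square M r s q h"
  shows "homotopy_cartesian M r s q h \<longleftrightarrow> homotopy_cartesian M (p \<cdot> r) s f (g \<cdot> h)"
proof -
  obtain b b' e f' g' p' q' u where R: "fibrant_replacement_cospan M f g b b' e f' g'"
      and P: "is_pullback M p' q' f' g'"
      and u: "u \<in> hom M (Dom M p) (Dom M p')" "p' \<cdot> u = b \<cdot> p" "q' \<cdot> u = b' \<cdot> q" "u \<in> Weq M"
      and sq0: "commutative_square M p q f g"
    using H unfolding homotopy_cartesian_def is_homotopy_pullback_def by blast
  obtain y z y' z' where h0: "p \<in> hom M y z" "q \<in> hom M y y'" "f \<in> hom M z z'" "g \<in> hom M y' z'"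
    and eq0: "f \<cdot> p = g \<cdot> q"
    using sq0 by (rule commutative_squareE)
  obtain v y1 v' y1' where h1: "r \<in> hom M v y1" "s \<in> hom M v v'" "q \<in> hom M y1 y1'" "h \<in> hom M v' y1'"
    and eq1: "q \<cdot> r = h \<cdot> s"
    using sq by (rule commutative_squareE)
  have y: "y1 = y" "y1' = y'" using h0(2) h1(3) by (simp_all add: hom_iff)
  note h = h0 h1(1,2,4)[unfolded y] and eq = eq0 eq1
  obtain zb yb eb where h': "b \<in> hom M z zb" "b' \<in> hom M y' yb" "e \<in> hom M z' eb" "f' \<in> hom M zb eb" "g' \<in> hom M yb eb"
    and w: "b \<in> Weq M" "b' \<in> Weq M" "e \<in> Weq M" "f' \<in> Fib M" "g' \<in> Fib M" "fibrant M eb"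
    and eq': "f' \<cdot> b = e \<cdot> f" "g' \<cdot> b' = e \<cdot> g"
    using R h(3,4) by (rule fibrant_replacement_cospanE)
  have "Dom M p = y" using h by (simp add: hom_iff)
  note u = u[unfolded this]
  have pq': "p' \<in> hom M (Dom M p') zb" "q' \<in> hom M (Dom M p') yb"
    using is_pullback_square[OF P] h'(4,5) by (simp_all add: commutative_square_def hom_iff)
  obtain x i k where i: "i \<in> hom M v' x" "k \<in> hom M x yb" "i \<in> Weq M" "k \<in> Fib M" "k \<cdot> i = b' \<cdot> h"
    using factor_Weq_Fib[OF Comp_hom[OF h(7) h'(2)]] .
  \<comment> \<open>Here the hypothesis on the right square enters: its gap map \<open>u\<close> is
    a weak equivalence, so its homotopy pullback may replace the middle object. The map
    \<open>q'\<close> is a fibration as a base change of \<open>f'\<close>, and \<open>yb\<close> is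
    fibrant because \<open>g'\<close> is a fibration with fibrant target.\<close>
  have Rl: "fibrant_replacement_cospan M q h u i b' q' k"
    by (rule fibrant_replacement_cospanI[OF h(2,7) u(1) i(1) h'(2) pq'(2) i(2) u(4) i(3) w(2) pullback_Fib[OF P w(4)] i(4)
          fibrant_dom[OF h'(5) w(5,6)] u(3) i(5)])
  have gk: "(g' \<cdot> k) \<cdot> i = e \<cdot> (g \<cdot> h)"
    using Comp_assoc[OF i(1,2) h'(5)] i(5) comp_square[OF eq'(2) h'(2,5) h(4) h'(3) h(7)] by simp
  have "g' \<cdot> k \<in> Fib M" using Fib_comp[OF i(4) w(5)] i(2) h'(5) by (simp add: hom_iff)
  \<comment> \<open>The replacement \<open>i\<close>, \<open>k\<close> of \<open>h\<close> also
    serves the outer cospan. By \<open>Po\<close> below the left and the outer square get the same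
    homotopy pullback and the same gap map \<open>w\<close>.\<close>
  then have Ro: "fibrant_replacement_cospan M f (g \<cdot> h) b i e f' (g' \<cdot> k)"
    using fibrant_replacement_cospanI[OF h(3) Comp_hom[OF h(7,4)] h'(1) i(1) h'(3,4) Comp_hom[OF i(2) h'(5)] w(1) i(3) w(3,4) _ w(6)
        eq'(1) gk] by blast
  obtain r' s' where Pl: "is_pullback M r' s' q' k" using pullback_exists[OF finite_limits pq'(2) i(2)] .
  have r': "r' \<in> hom M (Dom M r') (Dom M p')"
    using is_pullback_square[OF Pl] pq'(2) by (simp add: commutative_square_def hom_iff)
  note Po = is_pullback_paste[OF P Pl]
  have "q' \<cdot> (u \<cdot> r) = b' \<cdot> (q \<cdot> r)" by (rule comp_square[OF u(3,1) pq'(2) h(2) h'(2) h(5)])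
  also have "\<dots> = k \<cdot> (i \<cdot> s)" using comp_square[OF i(5,1,2) h(7) h'(2) h(6)] eq by simp
  finally obtain w where v: "w \<in> hom M v (Dom M r')" "r' \<cdot> w = u \<cdot> r" "s' \<cdot> w = i \<cdot> s"
    using is_pullback_induced[OF Pl r' pq'(2) i(2) Comp_hom[OF h(5) u(1)] Comp_hom[OF h(6) i(1)]] by blast
  have "(p' \<cdot> r') \<cdot> w = b \<cdot> (p \<cdot> r)"
    using Comp_assoc[OF v(1) r' pq'(1)] v comp_square[OF u(2,1) pq'(1) h(1) h'(1) h(5)] by simp
  moreover have "commutative_square M (p \<cdot> r) s f (g \<cdot> h)"
  proof (rule commutative_squareI[OF Comp_hom[OF h(5,1)] h(6,3) Comp_hom[OF h(7,4)]])
    show "f \<cdot> (p \<cdot> r) = (g \<cdot> h) \<cdot> s"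
      using comp_square[OF eq(1) h(1,3,2,4,5)] eq Comp_assoc[OF h(6,7,4)] by simp
  qed
  moreover have "w \<in> hom M (Dom M (p \<cdot> r)) (Dom M (p' \<cdot> r'))"
    using v(1) Comp_hom[OF h(5,1)] Comp_hom[OF r' pq'(1)] by (simp add: hom_iff)
  ultimately have "homotopy_cartesian M (p \<cdot> r) s f (g \<cdot> h) \<longleftrightarrow> w \<in> Weq M"
    using homotopy_cartesian_iff[OF _ Ro Po] v by blast
  moreover have "Dom M r = v" using h(5) by (simp add: hom_iff)
  ultimately show ?thesis
    using homotopy_cartesian_iff[OF sq Rl Pl] v by simp
qed

end

section \<open>Squares indexed by vertex sets\<close>

text \<open>\<open>Sq K A B\<close> stands for: the square of restrictions from \<open>K\<close> to
  \<open>A\<close> and \<open>B\<close>, and on to \<open>A \<inter> B\<close>, is homotopy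
  cartesian. In \<open>Sq_paste\<close> the known square lies inside \<open>A\<close> and shares the
  final corner \<open>A' \<inter> B\<close> with the composite. Isolating these rules lets one
  argument serve both orders of the vertices.\<close>

locale square_system =
  fixes Sq :: "nat set \<Rightarrow> nat set \<Rightarrow> nat set \<Rightarrow> bool"
  assumes Sq_sym: "Sq K A B \<Longrightarrow> Sq K B A"
    and Sq_self: "finite K \<Longrightarrow> B \<subseteq> K \<Longrightarrow> B \<noteq> {} \<Longrightarrow> Sq K K B"
    and Sq_paste: "finite K \<Longrightarrow> A \<subseteq> K \<Longrightarrow> B \<subseteq> K \<Longrightarrow> A' \<subseteq> A \<Longrightarrow> A' \<inter> B \<noteq> {} \<Longrightarrow> Sq A A' (A \<inter> B)
      \<Longrightarrow> Sq K A B \<longleftrightarrow> Sq K A' B"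
    and Sq_relabel: "finite K \<Longrightarrow> A \<subseteq> K \<Longrightarrow> B \<subseteq> K \<Longrightarrow> A \<inter> B \<noteq> {} \<Longrightarrow> strict_mono_on K f
      \<Longrightarrow> Sq (f ` K) (f ` A) (f ` B) \<longleftrightarrow> Sq K A B"
begin

definition lower :: bool where
  "lower \<longleftrightarrow> (\<forall>n i. 0 < i \<and> i < n \<longrightarrow> Sq {0..n + 1} {0..n} ({0..n + 1} - {i}))"

definition left :: bool where
  "left \<longleftrightarrow> (\<forall>n\<ge>3. \<forall>j\<le>n. Sq {0..n} ({0} \<union> {j..n}) {0..j})"

text \<open>This is the lower square for \<open>i = 1\<close>, relabelled by the map that fixes 0
  and sends 1, 2, ... to \<open>a\<close>, \<open>a + 1\<close>, ....\<close>

lemma lower_shift: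
  assumes lower and a: "0 < a" "a + 1 < m"
  shows "Sq ({0} \<union> {a..m}) ({0} \<union> {a..m - 1}) ({0} \<union> {a + 1..m})"
proof -
  define f where "f k = (if k = 0 then 0 else k + a - 1)" for k :: nat
  have mono: "strict_mono_on K f" for K using a by (auto simp: strict_mono_on_def f_def)
  have im: "f ` {0..l + 1} = {0} \<union> {a..l + a}" for l
  proof -
    have "y \<in> f ` {0..l + 1}" if "y = 0 \<or> a \<le> y \<and> y \<le> l + a" for y
    proof (cases "y = 0")
      case True
      then show ?thesis by (intro image_eqI[of _ _ 0]) (auto simp: f_def)
    next
      case False
      then show ?thesis using that by (intro image_eqI[of _ _ "y - a + 1"]) (auto simp: f_def)
    qed
    then have "{0} \<union> {a..l + a} \<subseteq> f ` {0..l + 1}" by auto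
    moreover have "f ` {0..l + 1} \<subseteq> {0} \<union> {a..l + a}" using a by (auto simp: f_def)
    ultimately show ?thesis by (rule equalityI[rotated])
  qed
  \<comment> \<open>With this \<open>n\<close> the last vertex \<open>n + 1\<close> is sent to
    \<open>m\<close>, and \<open>a + 1 < m\<close> becomes the bound \<open>1 < n\<close> that the
    lower square for \<open>i = 1\<close> requires.\<close>
  define n where "n = m - a"
  have n: "m = n + a" "1 < n" using a by (auto simp: n_def)
  have "Sq {0..n + 1} {0..n} ({0..n + 1} - {1})"
    using assms(1) n unfolding lower_def by blast
  then have "Sq (f ` {0..n + 1}) (f ` {0..n}) (f ` ({0..n + 1} - {1}))"
    using n by (subst Sq_relabel[OF _ _ _ _ mono]) auto
  moreover have "f ` {0..n + 1} = {0} \<union> {a..m}" using im[of n] n by simp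
  moreover have "f ` {0..n} = {0} \<union> {a..m - 1}" using im[of "n - 1"] n by simp
  moreover have "f ` ({0..n + 1} - {1}) = {0} \<union> {a + 1..m}"
  proof -
    have "inj f" using strict_mono_on_imp_inj_on[OF mono] .
    then have "f ` ({0..n + 1} - {1}) = f ` {0..n + 1} - {f 1}" by (simp add: image_set_diff)
    moreover have "f ` {0..n + 1} = {0} \<union> {a..m}" using im[of n] n by simp
    moreover have "f 1 = a" by (simp add: f_def)
    moreover have "({0} \<union> {a..m}) - {a} = {0} \<union> {a + 1..m}" using a by auto
    ultimately show ?thesis by simp
  qed
  ultimately show ?thesis by simp
qed

text \<open>The vertices 1, 2, ... are deleted one at a time, each deletion pasting on a shifted
  lower square. For \<open>j = 1\<close> nothing is deleted and the square is degenerate.\<close>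

lemma lower_omit_initial:
  assumes lower and "0 < j" "j < m"
  shows "Sq {0..m} {0..m - 1} ({0} \<union> {j..m})"
  using assms(2,3)
proof (induction j rule: nat_induct_non_zero)
  case 1
  have "{0} \<union> {1..m} = {0..m}" by auto
  then show ?case using Sq_sym[OF Sq_self[of "{0..m}" "{0..m - 1}"]] by simp
next
  case (Suc j)
  then have IH: "Sq {0..m} ({0} \<union> {j..m}) {0..m - 1}" using Sq_sym[OF Suc.IH] by simp
  have "({0} \<union> {j..m}) \<inter> {0..m - 1} = {0} \<union> {j..m - 1}" using Suc.prems by auto
  then have "Sq ({0} \<union> {j..m}) ({0} \<union> {j + 1..m}) (({0} \<union> {j..m}) \<inter> {0..m - 1})"
    using Sq_sym[OF lower_shift[OF assms(1), of j m]] Suc by simp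
  then have "Sq {0..m} ({0} \<union> {j + 1..m}) {0..m - 1}"
    using IH by (subst (asm) Sq_paste[of _ _ _ "{0} \<union> {j + 1..m}"]) auto
  then show ?case using Sq_sym by simp
qed

text \<open>The left square on \<open>{0..m - 1}\<close> sits next to the final corner; pasting it
  on shrinks \<open>{0..m - 1}\<close> to \<open>{0..j}\<close>. Both implications between the two
  conditions pass through this equivalence.\<close>

lemma left_square_step:
  assumes S: "Sq {0..m - 1} ({0} \<union> {j..m - 1}) {0..j}" and j: "j < m"
  shows "Sq {0..m} {0..m - 1} ({0} \<union> {j..m}) \<longleftrightarrow> Sq {0..m} ({0} \<union> {j..m}) {0..j}"
proof -
  have "{0..m - 1} \<inter> ({0} \<union> {j..m}) = {0} \<union> {j..m - 1}" using j by auto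
  then have "Sq {0..m - 1} {0..j} ({0..m - 1} \<inter> ({0} \<union> {j..m}))" using Sq_sym[OF S] by simp
  then have "Sq {0..m} {0..m - 1} ({0} \<union> {j..m}) \<longleftrightarrow> Sq {0..m} {0..j} ({0} \<union> {j..m})"
    using j by (intro Sq_paste) auto
  then show ?thesis using Sq_sym by blast
qed

text \<open>One of the two vertex sets is then all of \<open>{0..n}\<close>. For
  \<open>n \<le> 2\<close>, where \<open>left\<close> asserts nothing, every \<open>j\<close> is of
  this kind.\<close>

lemma left_square_trivial:
  assumes "j \<le> n" "j \<le> 1 \<or> j = n"
  shows "Sq {0..n} ({0} \<union> {j..n}) {0..j}"
proof -
  consider "j \<le> 1" | "j = n" using assms by blast
  then show ?thesis
  proof cases
    case 1
    then have "{0} \<union> {j..n} = {0..n}" by auto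
    then show ?thesis using Sq_self[of "{0..n}" "{0..j}"] assms(1) by simp
  next
    case 2
    then show ?thesis using Sq_sym[OF Sq_self[of "{0..n}" "{0} \<union> {j..n}"]] by simp
  qed
qed

text \<open>Induction on \<open>n\<close> from the degenerate case \<open>n = j\<close>;
  \<open>left_square_step\<close> adds the last vertex.\<close>

lemma lower_imp_left_square:
  assumes lower and "j \<le> n"
  shows "Sq {0..n} ({0} \<union> {j..n}) {0..j}"
proof (cases "j = 0")
  case True
  then show ?thesis using left_square_trivial[OF assms(2)] by simp
next
  case False
  show ?thesis using assms(2)
  proof (induction n rule: dec_induct)
    case base
    then show ?case using left_square_trivial[of j j] by simp
  next
    case (step n)
    then show ?case
      using left_square_step[of "Suc n" j] lower_omit_initial[OF assms(1), of j "Suc n"] False by simp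
  qed
qed

text \<open>\<open>left_square_step\<close> read backwards: its hypothesis is the left square on
  \<open>{0..m - 1}\<close>, its right-hand side the one on \<open>{0..m}\<close>.\<close>

lemma left_imp_omit_initial:
  assumes left and "j < m"
  shows "Sq {0..m} {0..m - 1} ({0} \<union> {j..m})"
proof -
  have S: "Sq {0..n} ({0} \<union> {j..n}) {0..j}" if "j \<le> n" for n
  proof (cases "3 \<le> n")
    case True
    then show ?thesis using assms(1) that unfolding left_def by blast
  next
    case False
    then have "j \<le> 1 \<or> j = n" using that by auto
    then show ?thesis using left_square_trivial[OF that] by blast
  qed
  have "j \<le> m - 1" "j \<le> m" using assms(2) by auto
  then show ?thesis using left_square_step[OF S assms(2)] S by blast
qed

text \<open>Deleting \<open>1, ..., i\<close> amounts to deleting \<open>i\<close> and after that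
  the rest. The total deletion and the second one are both squares of
  \<open>left_imp_omit_initial\<close>, the latter on \<open>{0..n}\<close> relabelled around the
  gap at \<open>i\<close>. Cancelling leaves the deletion of \<open>i\<close> alone.\<close>

lemma left_imp_lower_square:
  assumes left and i: "0 < i" "i < n"
  shows "Sq {0..n + 1} {0..n} ({0..n + 1} - {i})"
proof -
  define f where "f k = (if k < i then k else k + 1)" for k
  have mono: "strict_mono_on K f" for K by (auto simp: strict_mono_on_def f_def)
  have im: "f ` {a..b} = {f a..f b} - {i}" for a b
  proof -
    have "{f a..f b} - {i} \<subseteq> f ` {a..b}"
    proof
      fix y assume y: "y \<in> {f a..f b} - {i}"
      show "y \<in> f ` {a..b}"
      proof (cases "y < i")
        case True
        then show ?thesis using y
          by (intro image_eqI[of _ _ y]) (auto simp: f_def split: if_splits)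
      next
        case False
        then show ?thesis using y
          by (intro image_eqI[of _ _ "y - 1"]) (auto simp: f_def split: if_splits)
      qed
    qed
    moreover have "f ` {a..b} \<subseteq> {f a..f b} - {i}" by (auto simp: f_def)
    ultimately show ?thesis by (rule equalityI[rotated])
  qed
  let ?A = "{0..n + 1} - {i}"
  have "Sq {0..n} {0..n - 1} ({0} \<union> {i..n})"
    using left_imp_omit_initial[OF assms(1)] i by simp
  then have "Sq {0..n} ({0} \<union> {i..n}) {0..n - 1}" by (rule Sq_sym)
  then have Sqf: "Sq (f ` {0..n}) (f ` ({0} \<union> {i..n})) (f ` {0..n - 1})"
    by (subst Sq_relabel[OF _ _ _ _ mono]) auto
  have fv: "f 0 = 0" "f i = i + 1" "f n = n + 1" "f (n - 1) = n" using i by (auto simp: f_def)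
  have "f ` {0..n} = ?A" "f ` {0..n - 1} = ?A \<inter> {0..n}" "f ` ({0} \<union> {i..n}) = {0} \<union> {i + 1..n + 1}"
    using i unfolding image_Un im fv by (auto simp: fv)
  then have "Sq ?A ({0} \<union> {i + 1..n + 1}) (?A \<inter> {0..n})" using Sqf by simp
  then have "Sq {0..n + 1} ?A {0..n} \<longleftrightarrow> Sq {0..n + 1} ({0} \<union> {i + 1..n + 1}) {0..n}"
    using i by (intro Sq_paste) auto
  moreover have S: "Sq {0..n + 1} {0..n} ({0} \<union> {i + 1..n + 1})"
    using left_imp_omit_initial[OF assms(1), of "i + 1" "n + 1"] i by simp
  ultimately have "Sq {0..n + 1} ?A {0..n}" using Sq_sym[OF S] by simp
  then show ?thesis by (rule Sq_sym)
qed

lemma lower_iff_left: "lower \<longleftrightarrow> left"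
  using lower_imp_left_square left_imp_lower_square unfolding lower_def left_def by blast

end

section \<open>Reversal of the vertex order\<close>

definition reflect :: "nat set \<Rightarrow> nat \<Rightarrow> nat" where
  "reflect K x = Max K - x"

text \<open>\<open>reflect\<close> depends on the vertex set, so two things need repair: in the
  pasting rule \<open>A\<close> is reversed once by its own maximum and once by that of
  \<open>K\<close>, and a relabelling turns into its conjugate. Both discrepancies are strictly
  increasing maps, which \<open>Sq_relabel\<close> absorbs.\<close>

lemma (in square_system) square_system_reflect:
  "square_system (\<lambda>K A B. Sq (reflect K ` K) (reflect K ` A) (reflect K ` B))"
proof
  fix K A B A' :: "nat set" and f :: "nat \<Rightarrow> nat"
  have inj: "inj_on (reflect K) K" if "finite K" for K
  proof (rule inj_onI)
    fix x y assume "x \<in> K" "y \<in> K" "reflect K x = reflect K y"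
    then show "x = y" using Max_ge[OF that, of x] Max_ge[OF that, of y] by (simp add: reflect_def)
  qed
  have int: "reflect K ` (A \<inter> B) = reflect K ` A \<inter> reflect K ` B" if "finite K" "A \<subseteq> K" "B \<subseteq> K" for K A B
    using inj_on_image_Int[OF inj[OF that(1)] that(2,3)] .
  show "Sq (reflect K ` K) (reflect K ` A) (reflect K ` B) \<Longrightarrow> Sq (reflect K ` K) (reflect K ` B) (reflect K ` A)"
    by (rule Sq_sym)
  show "Sq (reflect K ` K) (reflect K ` K) (reflect K ` B)" if "finite K" "B \<subseteq> K" "B \<noteq> {}"
    using that by (intro Sq_self) auto
  show "Sq (reflect K ` K) (reflect K ` A) (reflect K ` B) \<longleftrightarrow> Sq (reflect K ` K) (reflect K ` A') (reflect K ` B)"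
    if fin: "finite K" and sub: "A \<subseteq> K" "B \<subseteq> K" "A' \<subseteq> A" and ne: "A' \<inter> B \<noteq> {}"
      and S: "Sq (reflect A ` A) (reflect A ` A') (reflect A ` (A \<inter> B))"
  proof -
    have finA: "finite A" using fin sub finite_subset by blast
    have neA: "reflect A ` A' \<inter> reflect A ` (A \<inter> B) \<noteq> {}" using ne sub(3) by blast
    have neK: "reflect K ` A' \<inter> reflect K ` B \<noteq> {}" using ne by blast
    \<comment> \<open>The offset between the two reversals of \<open>A\<close>; it is exact because
      \<open>Max A \<le> Max K\<close>.\<close>
    define h where "h = (\<lambda>x. x + (Max K - Max A))"
    have "Max A \<le> Max K" using sub ne fin by (intro Max_mono) auto
    then have "h (reflect A x) = reflect K x" if "x \<in> A" for x
      using Max_ge[OF finA that] by (simp add: h_def reflect_def)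
    then have h: "h ` reflect A ` C = reflect K ` C" if "C \<subseteq> A" for C
      using that by (force simp: image_image)
    have "Sq (h ` reflect A ` A) (h ` reflect A ` A') (h ` reflect A ` (A \<inter> B))"
      using S sub finA neA
      by (subst Sq_relabel) (auto simp: strict_mono_on_def h_def)
    then have "Sq (reflect K ` A) (reflect K ` A') (reflect K ` A \<inter> reflect K ` B)"
      using h[of A] h[of A'] h[of "A \<inter> B"] int[OF fin sub(1,2)] sub by auto
    then show ?thesis
      using fin sub neK by (intro Sq_paste image_mono finite_imageI)
  qed
  show "Sq (reflect (f ` K) ` f ` K) (reflect (f ` K) ` f ` A) (reflect (f ` K) ` f ` B) \<longleftrightarrow>
      Sq (reflect K ` K) (reflect K ` A) (reflect K ` B)"
    if fin: "finite K" and sub: "A \<subseteq> K" "B \<subseteq> K" and ne: "A \<inter> B \<noteq> {}" and f: "strict_mono_on K f"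
  proof -
    define N where "N = Max K"
    have N: "N \<in> K" "\<And>x. x \<in> K \<Longrightarrow> x \<le> N" using Max_in[OF fin] Max_ge[OF fin] sub(1) ne unfolding N_def by blast+
    have le: "f x \<le> f N" if "x \<in> K" for x
      using strict_mono_on_leD[OF f that N(1) N(2)[OF that]] .
    have "Max (f ` K) = f N" using fin N le by (intro Max_eqI) auto
    then have R: "reflect (f ` K) (f x) = f N - f (N - reflect K x)" if "x \<in> K" for x
      using N(2)[OF that] by (simp add: reflect_def N_def)
    define g where "g = (\<lambda>y. f N - f (N - y))"
    have mono: "strict_mono_on (reflect K ` K) g"
    proof (rule strict_mono_onI)
      fix y z assume "y \<in> reflect K ` K" "z \<in> reflect K ` K" and yz: "y < z"
      then obtain a b where ab: "a \<in> K" "b \<in> K" "y = N - a" "z = N - b" by (auto simp: reflect_def N_def)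
      have "f b < f a" using strict_mono_onD[OF f ab(2,1)] ab yz by simp
      moreover have "N - y = a" "N - z = b" using ab N(2) by auto
      ultimately show "g y < g z" using le[OF ab(1)] by (simp add: g_def)
    qed
    have im: "reflect (f ` K) ` f ` C = g ` reflect K ` C" if "C \<subseteq> K" for C
      using R that unfolding image_image g_def by (intro image_cong) auto
    show ?thesis
      using fin sub ne int[OF fin sub] by (simp add: im, intro Sq_relabel[OF _ _ _ _ mono]) auto
  qed
qed

section \<open>Restriction maps of a simplicial object\<close>

text \<open>Taking the element at a position and counting the smaller elements are mutually inverse.
  This and the next lemma make \<open>inclusion\<close> respect identities and composition.\<close>

lemma card_less_sorted_list_of_set:
  assumes "finite (J :: nat set)" "i < card J"
  shows "card {z \<in> J. z < sorted_list_of_set J ! i} = i"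
proof -
  let ?xs = "sorted_list_of_set J"
  have len: "length ?xs = card J" using assms by simp
  have mono: "?xs ! k < ?xs ! l \<longleftrightarrow> k < l" if "k < card J" "l < card J" for k l
    using sorted_wrt_nth_less[OF strict_sorted_list_of_set, of k l J]
      sorted_wrt_nth_less[OF strict_sorted_list_of_set, of l k J] that len
    by (cases k l rule: linorder_cases) auto
  have "J = (!) ?xs ` {..<card J}"
    using assms len by (metis set_sorted_list_of_set set_conv_nth lessThan_def setcompr_eq_image)
  then have "{z \<in> J. z < ?xs ! i} = {z \<in> (!) ?xs ` {..<card J}. z < ?xs ! i}" by simp
  also have "\<dots> = (!) ?xs ` {..<i}" using mono assms(2) by auto
  finally have "card {z \<in> J. z < ?xs ! i} = card ((!) ?xs ` {..<i})" by simp
  also have "\<dots> = i"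
    using inj_on_nth[of ?xs "{..<i}"] assms by (simp add: card_image)
  finally show ?thesis .
qed

lemma sorted_list_of_set_nth_card:
  assumes "finite (J :: nat set)" "x \<in> J"
  shows "card {z \<in> J. z < x} < card J" and "sorted_list_of_set J ! card {z \<in> J. z < x} = x"
proof -
  obtain i where "i < card J" "x = sorted_list_of_set J ! i"
    using assms by (metis in_set_conv_nth length_sorted_list_of_set set_sorted_list_of_set)
  then show "card {z \<in> J. z < x} < card J" "sorted_list_of_set J ! card {z \<in> J. z < x} = x"
    using card_less_sorted_list_of_set[OF assms(1)] by auto
qed

lemma inclusion_comp:
  assumes "finite K" "J \<subseteq> K" "I \<subseteq> J" "I \<noteq> {}"
  shows "Comp Delta (inclusion J K) (inclusion I J) = inclusion I K"
proof -
  have fin: "finite J" "finite I"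
    using finite_subset[OF assms(2,1)] finite_subset[OF assms(3) finite_subset[OF assms(2,1)]] .
  then have "0 < card I" using assms(4) by (simp add: card_gt_0_iff)
  have "sorted_list_of_set I ! k \<in> J" if "k \<le> card I - 1" for k
  proof -
    have "k < length (sorted_list_of_set I)" using that \<open>0 < card I\<close> by simp
    then have "sorted_list_of_set I ! k \<in> set (sorted_list_of_set I)" by (rule nth_mem)
    then show ?thesis using fin assms by auto
  qed
  moreover have "card {z \<in> J. z < x} \<le> card J - 1" if "x \<in> J" for x
    using sorted_list_of_set_nth_card(1)[OF fin(1) that] by simp
  ultimately show ?thesis
    using sorted_list_of_set_nth_card(2)[OF fin(1)]
    by (simp add: inclusion_def Delta_def compose_def restrict_def fun_eq_iff)
qed

lemma inclusion_self:
  assumes "finite J" "J \<noteq> {}"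
  shows "inclusion J J = Ident Delta (card J - 1)"
proof -
  have "0 < card J" using assms by (simp add: card_gt_0_iff)
  then have "k \<le> card J - 1 \<longleftrightarrow> k < card J" for k by linarith
  then show ?thesis
    using card_less_sorted_list_of_set[OF assms(1)]
    by (simp add: inclusion_def Delta_def restrict_def fun_eq_iff)
qed

text \<open>Positions depend on the order of the elements alone, not on their values. This is the
  source of \<open>Sq_relabel\<close>.\<close>

lemma inclusion_image:
  assumes "finite J" "I \<subseteq> J" "I \<noteq> {}" "strict_mono_on J f"
  shows "inclusion (f ` I) (f ` J) = inclusion I J"
proof -
  have inj: "inj_on f J" using assms(4) by (rule strict_mono_on_imp_inj_on)
  have fin: "finite I" using finite_subset[OF assms(2,1)] .
  then have "0 < card I" using assms(3) by (simp add: card_gt_0_iff)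
  let ?xs = "sorted_list_of_set I"
  have cI: "card (f ` I) = card I" "card (f ` J) = card J"
    using inj inj_on_subset[OF inj assms(2)] by (simp_all add: card_image)
  have "sorted_wrt (<) (map f ?xs)"
  proof -
    have "sorted_wrt (\<lambda>x y. f x < f y) ?xs"
      by (rule sorted_wrt_mono_rel[OF _ strict_sorted_list_of_set[of I]])
        (use fin assms in \<open>auto intro: strict_mono_onD\<close>)
    then show ?thesis by (simp add: sorted_wrt_map)
  qed
  then have "sorted_list_of_set (set (map f ?xs)) = map f ?xs"
    by (intro sorted_list_of_set.idem_if_sorted_distinct) (auto simp: strict_sorted_iff)
  then have sl: "sorted_list_of_set (f ` I) = map f ?xs" using fin by simp
  have less: "card {y \<in> f ` J. y < f x} = card {y \<in> J. y < x}" if "x \<in> J" for x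
  proof -
    have "f y < f x \<longleftrightarrow> y < x" if "y \<in> J" for y
      using strict_mono_on_less[OF assms(4)] that \<open>x \<in> J\<close> by blast
    then have "{y \<in> f ` J. y < f x} = f ` {y \<in> J. y < x}" by blast
    moreover have "inj_on f {y \<in> J. y < x}" using inj by (rule inj_on_subset) auto
    ultimately show ?thesis by (simp add: card_image)
  qed
  have "card {y \<in> f ` J. y < sorted_list_of_set (f ` I) ! k} = card {y \<in> J. y < ?xs ! k}"
    if "k \<le> card I - 1" for k
  proof -
    have k: "k < length ?xs" using that \<open>0 < card I\<close> by simp
    then have "?xs ! k \<in> set ?xs" by (rule nth_mem)
    then have "?xs ! k \<in> J" using fin assms by auto
    then show ?thesis using less k by (simp add: sl)
  qed
  then show ?thesis by (simp add: inclusion_def cI restrict_def fun_eq_iff)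
qed

lemma restr_image:
  "finite J \<Longrightarrow> I \<subseteq> J \<Longrightarrow> I \<noteq> {} \<Longrightarrow> strict_mono_on J f \<Longrightarrow> restr X (f ` J) (f ` I) = restr X J I"
  by (simp add: restr_def inclusion_image)

lemma face_eq_restr: "0 < n \<Longrightarrow> i \<le> n \<Longrightarrow> face X n i = restr X {0..n} ({0..n} - {i})"
  by (simp add: face_def restr_def coface_eq_inclusion)

lemma restr_hom:
  assumes X: "simplicial_object C X" and I: "finite J" "I \<subseteq> J" "I \<noteq> {}"
  shows "restr X J I \<in> hom C (on_obj X (card J - 1)) (on_obj X (card I - 1))"
proof -
  have "inclusion I J \<in> hom (op_category Delta) (card J - 1) (card I - 1)"
    using inclusion_hom[OF I] by (simp add: op_category_def hom_def)
  then show ?thesis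
    using X unfolding simplicial_object_def is_functor_def restr_def
    by (simp add: op_category_def Delta_def)
qed

lemma restr_comp:
  assumes X: "simplicial_object C X" and I: "finite K" "J \<subseteq> K" "I \<subseteq> J" "I \<noteq> {}"
  shows "restr X J I \<cdot>\<^bsub>C\<^esub> restr X K J = restr X K I"
proof -
  have J: "finite J" "J \<noteq> {}" using finite_subset[OF I(2,1)] I(3,4) by auto
  let ?f = "inclusion J K" and ?g = "inclusion I J"
  have "?f \<in> hom Delta (card J - 1) (card K - 1)" "?g \<in> hom Delta (card I - 1) (card J - 1)"
    using inclusion_hom I J by auto
  then have "?f \<in> Arr (op_category Delta)" "?g \<in> Arr (op_category Delta)"
    "Cod (op_category Delta) ?f = Dom (op_category Delta) ?g"
    by (auto simp: op_category_def hom_def)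
  then have "on_arr X (?g \<cdot>\<^bsub>op_category Delta\<^esub> ?f) = on_arr X ?g \<cdot>\<^bsub>C\<^esub> on_arr X ?f"
    using X unfolding simplicial_object_def is_functor_def by blast
  moreover have "?g \<cdot>\<^bsub>op_category Delta\<^esub> ?f = inclusion I K"
    using inclusion_comp[OF I] by (simp add: op_category_def)
  ultimately show ?thesis by (simp add: restr_def)
qed

lemma restr_self:
  assumes X: "simplicial_object C X" and J: "finite J" "J \<noteq> {}"
  shows "restr X J J = Ident C (on_obj X (card J - 1))"
  using X inclusion_self[OF J] unfolding simplicial_object_def is_functor_def restr_def
  by (simp add: op_category_def Delta_def)

section \<open>Squares of restriction maps as a system of squares\<close>

definition restr_square ::
    "('o, 'm, 'z) model_structure_scheme \<Rightarrow> ('o, 'm) simplicial \<Rightarrow> nat set \<Rightarrow> nat set \<Rightarrow> nat set \<Rightarrow> bool" where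
  "restr_square M X K A B \<longleftrightarrow>
     homotopy_cartesian M (restr X K A) (restr X K B) (restr X A (A \<inter> B)) (restr X B (A \<inter> B))"

context model_category
begin

lemma commutative_restr_square:
  assumes X: "simplicial_object M X" and K: "finite K" "A \<subseteq> K" "B \<subseteq> K" "A \<inter> B \<noteq> {}"
  shows "commutative_square M (restr X K A) (restr X K B) (restr X A (A \<inter> B)) (restr X B (A \<inter> B))"
proof -
  have fin: "finite A" "finite B" "A \<noteq> {}" "B \<noteq> {}"
    using finite_subset[OF K(2,1)] finite_subset[OF K(3,1)] K(4) by auto
  show ?thesis
  proof (rule commutative_squareI)
    show "restr X A (A \<inter> B) \<cdot> restr X K A = restr X B (A \<inter> B) \<cdot> restr X K B"
      using restr_comp[OF X K(1,2) Int_lower1 K(4)] restr_comp[OF X K(1,3) Int_lower2 K(4)] by simp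
    show "restr X K A \<in> hom M (on_obj X (card K - 1)) (on_obj X (card A - 1))"
      by (rule restr_hom[OF X K(1,2) fin(3)])
    show "restr X K B \<in> hom M (on_obj X (card K - 1)) (on_obj X (card B - 1))"
      by (rule restr_hom[OF X K(1,3) fin(4)])
    show "restr X A (A \<inter> B) \<in> hom M (on_obj X (card A - 1)) (on_obj X (card (A \<inter> B) - 1))"
      by (rule restr_hom[OF X fin(1) Int_lower1 K(4)])
    show "restr X B (A \<inter> B) \<in> hom M (on_obj X (card B - 1)) (on_obj X (card (A \<inter> B) - 1))"
      by (rule restr_hom[OF X fin(2) Int_lower2 K(4)])
  qed
qed

lemma square_system_restr:
  assumes X: "simplicial_object M X"
  shows "square_system (restr_square M X)"
proof
  fix K A B A' :: "nat set" and f :: "nat \<Rightarrow> nat"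
  show sym: "restr_square M X K B A" if "restr_square M X K A B" for K A B
    using that unfolding restr_square_def
    by (subst homotopy_cartesian_sym) (simp add: Int_commute)
  show "restr_square M X K K B" if K: "finite K" "B \<subseteq> K" "B \<noteq> {}"
  proof -
    have "restr X K K \<in> Weq M" "restr X B B \<in> Weq M"
    proof -
      have "restr X J J \<in> Weq M" if "finite J" "J \<noteq> {}" for J
        using restr_self[OF X that] hom_Obj(1)[OF restr_hom[OF X that(1) subset_refl that(2)]] Ident_Weq by simp
      then show "restr X K K \<in> Weq M" "restr X B B \<in> Weq M"
        using K finite_subset[OF K(2,1)] by auto
    qed
    moreover have "B \<inter> K = B" "K \<inter> B = B" using K by auto
    \<comment> \<open>In this transposed position the two identity edges are the parallel pair
      \<open>q\<close>, \<open>f\<close> of \<open>homotopy_cartesian_Weq\<close>.\<close>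
    ultimately have "restr_square M X K B K"
      using commutative_restr_square[OF X K(1,2) subset_refl] K
      unfolding restr_square_def by (intro homotopy_cartesian_Weq) auto
    then show ?thesis by (rule sym)
  qed
  show "restr_square M X K A B \<longleftrightarrow> restr_square M X K A' B"
    if K: "finite K" "A \<subseteq> K" "B \<subseteq> K" "A' \<subseteq> A" "A' \<inter> B \<noteq> {}"
      and S: "restr_square M X A A' (A \<inter> B)"
  proof -
    have ne: "A \<inter> B \<noteq> {}" "A' \<noteq> {}" using K by auto
    \<comment> \<open>Thus the final corner of the square inside \<open>A\<close> is that of the
      composite square.\<close>
    have AB: "A' \<inter> (A \<inter> B) = A' \<inter> B" using K by auto
    have H: "homotopy_cartesian M (restr X A A') (restr X A (A \<inter> B)) (restr X A' (A' \<inter> B)) (restr X (A \<inter> B) (A' \<inter> B))"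
      using S unfolding restr_square_def AB .
    have 1: "restr X A A' \<cdot> restr X K A = restr X K A'"
      by (rule restr_comp[OF X K(1,2,4) ne(2)])
    have 2: "restr X (A \<inter> B) (A' \<inter> B) \<cdot> restr X B (A \<inter> B) = restr X B (A' \<inter> B)"
      by (rule restr_comp[OF X finite_subset[OF K(3,1)]]) (use K in auto)
    show ?thesis
      using homotopy_cartesian_paste[OF H commutative_restr_square[OF X K(1-3) ne(1)]]
      unfolding restr_square_def 1 2 .
  qed
  show "restr_square M X (f ` K) (f ` A) (f ` B) \<longleftrightarrow> restr_square M X K A B"
    if K: "finite K" "A \<subseteq> K" "B \<subseteq> K" "A \<inter> B \<noteq> {}" and f: "strict_mono_on K f"
  proof -
    have fin: "finite A" "finite B" "A \<noteq> {}" "B \<noteq> {}"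
      using finite_subset[OF K(2,1)] finite_subset[OF K(3,1)] K(4) by auto
    have mono: "strict_mono_on A f" "strict_mono_on B f"
      using f K by (auto simp: strict_mono_on_def)
    have int: "f ` A \<inter> f ` B = f ` (A \<inter> B)"
      using inj_on_image_Int[OF strict_mono_on_imp_inj_on[OF f] K(2,3)] by simp
    show ?thesis
      unfolding restr_square_def int
      using K fin by (simp add: restr_image[OF _ _ _ f] restr_image[OF _ _ _ mono(1)] restr_image[OF _ _ _ mono(2)])
  qed
qed

end

section \<open>Face maps and the translation of the four conditions\<close>

text \<open>Of two vertices \<open>i < k\<close>, the vertex \<open>i\<close> keeps its position
  when \<open>k\<close> is deleted, while \<open>k\<close> moves to \<open>k - 1\<close> when
  \<open>i\<close> is deleted: the simplicial identity for two faces, in terms of vertex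
  sets.\<close>

lemma face_omit_commuted:
  assumes "i < k" "k \<le> n + 1" "0 < n"
  shows "face X n i = restr X ({0..n + 1} - {k}) ({0..n + 1} - {i, k})"
    and "face X n (k - 1) = restr X ({0..n + 1} - {i}) ({0..n + 1} - {i, k})"
proof -
  define skip where "skip l x = (if x < l then x else x + 1)" for l x :: nat
  have mono: "strict_mono_on K (skip l)" for K l by (auto simp: strict_mono_on_def skip_def)
  have im: "skip l ` {0..n} = {0..n + 1} - {l}" if "l \<le> n + 1" for l
  proof
    show "skip l ` {0..n} \<subseteq> {0..n + 1} - {l}" by (auto simp: skip_def)
    show "{0..n + 1} - {l} \<subseteq> skip l ` {0..n}"
    proof
      fix y assume y: "y \<in> {0..n + 1} - {l}"
      show "y \<in> skip l ` {0..n}"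
        using y that by (intro image_eqI[of _ _ "if y < l then y else y - 1"]) (auto simp: skip_def)
    qed
  qed
  have skip_face: "face X n j = restr X ({0..n + 1} - {l}) ({0..n + 1} - {l} - {skip l j})"
    if "l \<le> n + 1" "j \<le> n" for l j
  proof -
    have "{0..n} - {j} \<noteq> {}"
    proof (cases "j = 0")
      case True
      then have "n \<in> {0..n} - {j}" using assms(3) by simp
      then show ?thesis by blast
    next
      case False
      then have "0 \<in> {0..n} - {j}" by simp
      then show ?thesis by blast
    qed
    then have "restr X (skip l ` {0..n}) (skip l ` ({0..n} - {j})) = restr X {0..n} ({0..n} - {j})"
      by (intro restr_image mono) auto
    moreover have "skip l ` ({0..n} - {j}) = skip l ` {0..n} - {skip l j}"
      using strict_mono_on_imp_inj_on[OF mono[of UNIV l]] by (simp add: image_set_diff)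
    ultimately show ?thesis using face_eq_restr[of n j X] assms(3) that im by simp
  qed
  have "{0..n + 1} - {k} - {i} = {0..n + 1} - {i, k}" "{0..n + 1} - {i} - {k} = {0..n + 1} - {i, k}" by auto
  then show "face X n i = restr X ({0..n + 1} - {k}) ({0..n + 1} - {i, k})"
    "face X n (k - 1) = restr X ({0..n + 1} - {i}) ({0..n + 1} - {i, k})"
    using skip_face[of k i] skip_face[of i "k - 1"] assms by (simp_all add: skip_def)
qed

lemma restr_square_faces:
  assumes "i < k" "k \<le> n + 1" "0 < n"
  shows "restr_square M X {0..n + 1} ({0..n + 1} - {k}) ({0..n + 1} - {i}) \<longleftrightarrow>
    homotopy_cartesian M (face X (n + 1) k) (face X (n + 1) i) (face X n i) (face X n (k - 1))"
proof -
  have "({0..n + 1} - {k}) \<inter> ({0..n + 1} - {i}) = {0..n + 1} - {i, k}" by auto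
  then show ?thesis
    using face_omit_commuted[OF assms, of X] face_eq_restr[of "n + 1" k X] face_eq_restr[of "n + 1" i X] assms
    unfolding restr_square_def by simp
qed

theorem propositionA3:
  fixes D :: "('o, 'm, 'z) model_structure_scheme"
    and X :: "('o, 'm) simplicial"
  assumes "model_category D"
    and "simplicial_object D X"
  shows "(upper_2_Segal D X \<longleftrightarrow> right_2_Segal D X) \<and> (lower_2_Segal D X \<longleftrightarrow> left_2_Segal D X)"
proof -
  interpret model_category D by (fact assms(1))
  interpret S: square_system "restr_square D X" by (rule square_system_restr[OF assms(2)])
  let ?R = "\<lambda>K A B. restr_square D X (reflect K ` K) (reflect K ` A) (reflect K ` B)"
  interpret R: square_system ?R by (rule S.square_system_reflect)
  have S_lower: "lower_2_Segal D X \<longleftrightarrow> S.lower"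
  proof -
    have "homotopy_cartesian D (face X (n + 1) (n + 1)) (face X (n + 1) i) (face X n i) (face X n n) \<longleftrightarrow>
        restr_square D X {0..n + 1} {0..n} ({0..n + 1} - {i})" if "0 < i" "i < n" for n i
    proof -
      have "{0..n + 1} - {n + 1} = {0..n}" by auto
      then show ?thesis using restr_square_faces[of i "n + 1" n D X] that by simp
    qed
    then show ?thesis unfolding lower_2_Segal_def S.lower_def by blast
  qed
  have S_left: "left_2_Segal D X \<longleftrightarrow> S.left"
  proof -
    have "({0} \<union> {j..n}) \<inter> {0..j} = {0, j}" if "j \<le> n" for j n :: nat using that by auto
    then show ?thesis unfolding left_2_Segal_def S.left_def restr_square_def by simp
  qed
  have refl: "reflect {0..n} ` {a..b} = {n - b..n - a}" if "b \<le> n" "a \<le> b" for a b n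
  proof -
    have "Max {0..n} = n" by (intro Max_eqI) auto
    then have M: "reflect {0..n} x = n - x" for x by (simp add: reflect_def)
    show ?thesis
    proof
      show "reflect {0..n} ` {a..b} \<subseteq> {n - b..n - a}" by (auto simp: M)
      show "{n - b..n - a} \<subseteq> reflect {0..n} ` {a..b}"
      proof
        fix y assume "y \<in> {n - b..n - a}"
        then show "y \<in> reflect {0..n} ` {a..b}"
          using that by (intro image_eqI[of _ _ "n - y"]) (auto simp: M)
      qed
    qed
  qed
  have R_lower: "upper_2_Segal D X \<longleftrightarrow> R.lower"
  proof -
    \<comment> \<open>Reversing \<open>{0..n + 1}\<close> sends \<open>n + 1\<close> to 0 and
      \<open>n - i\<close> to \<open>i + 1\<close>, so the upper square for \<open>i\<close> is the
      reversed lower square for \<open>n - i\<close>.\<close>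
    have *: "homotopy_cartesian D (face X (n + 1) 0) (face X (n + 1) (i + 1)) (face X n i) (face X n 0) \<longleftrightarrow>
        ?R {0..n + 1} {0..n} ({0..n + 1} - {n - i})" if i: "0 < i" "i < n" for n i
    proof -
      have "{0..n + 1} - {n - i} = {0..n - i - 1} \<union> {n - i + 1..n + 1}" using i by auto
      then have "reflect {0..n + 1} ` ({0..n + 1} - {n - i}) = {i + 2..n + 1} \<union> {0..i}"
        using i refl[of "n - i - 1" "n + 1" 0] refl[of "n + 1" "n + 1" "n - i + 1"] by (simp add: image_Un)
      also have "\<dots> = {0..n + 1} - {i + 1}" using i by auto
      finally have r1: "reflect {0..n + 1} ` ({0..n + 1} - {n - i}) = {0..n + 1} - {i + 1}" .
      have r2: "reflect {0..n + 1} ` {0..n} = {0..n + 1} - {0}" using refl[of n "n + 1" 0] by auto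
      have r3: "reflect {0..n + 1} ` {0..n + 1} = {0..n + 1}" using refl[of "n + 1" "n + 1" 0] by simp
      have "?R {0..n + 1} {0..n} ({0..n + 1} - {n - i}) \<longleftrightarrow>
          restr_square D X {0..n + 1} ({0..n + 1} - {0}) ({0..n + 1} - {i + 1})"
        unfolding r1 r2 r3 ..
      \<comment> \<open>Transposed because \<open>restr_square_faces\<close> expects the smaller
        deleted vertex, here 0, in second place.\<close>
      also have "\<dots> \<longleftrightarrow> restr_square D X {0..n + 1} ({0..n + 1} - {i + 1}) ({0..n + 1} - {0})"
        using S.Sq_sym by blast
      also have "\<dots> \<longleftrightarrow> homotopy_cartesian D (face X (n + 1) (i + 1)) (face X (n + 1) 0) (face X n 0) (face X n i)"
        using restr_square_faces[of 0 "i + 1" n D X] i by simp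
      also have "\<dots> \<longleftrightarrow> homotopy_cartesian D (face X (n + 1) 0) (face X (n + 1) (i + 1)) (face X n i) (face X n 0)"
        by (rule homotopy_cartesian_sym)
      finally show ?thesis by simp
    qed
    show ?thesis
    proof
      assume U: "upper_2_Segal D X"
      show R.lower
        unfolding R.lower_def
      proof (intro allI impI)
        fix n i :: nat assume i: "0 < i \<and> i < n"
        then have "homotopy_cartesian D (face X (n + 1) 0) (face X (n + 1) (n - i + 1)) (face X n (n - i)) (face X n 0)"
          using U unfolding upper_2_Segal_def by simp
        then show "?R {0..n + 1} {0..n} ({0..n + 1} - {i})" using *[of "n - i" n] i by simp
      qed
    next
      assume L: R.lower
      show "upper_2_Segal D X"
        unfolding upper_2_Segal_def
      proof (intro allI impI)
        fix n i :: nat assume i: "0 < i \<and> i < n"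
        then have "?R {0..n + 1} {0..n} ({0..n + 1} - {n - i})"
          using L unfolding R.lower_def by simp
        then show "homotopy_cartesian D (face X (n + 1) 0) (face X (n + 1) (i + 1)) (face X n i) (face X n 0)"
          using *[of i n] i by simp
      qed
    qed
  qed
  have R_left: "right_2_Segal D X \<longleftrightarrow> R.left"
  proof -
    \<comment> \<open>Reversing \<open>{0..n}\<close> exchanges \<open>j\<close> with
      \<open>n - j\<close>, and the first vertex 0 of the left square with the last vertex
      \<open>n\<close> of the right one.\<close>
    have *: "?R {0..n} ({0} \<union> {n - j..n}) {0..n - j} \<longleftrightarrow> homotopy_cartesian D
        (restr X {0..n} ({0..j} \<union> {n})) (restr X {0..n} {j..n})
        (restr X ({0..j} \<union> {n}) {j, n}) (restr X {j..n} {j, n})" if "j \<le> n" for n j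
    proof -
      have r1: "reflect {0..n} ` ({0} \<union> {n - j..n}) = {0..j} \<union> {n}"
        using refl[of n n "n - j"] refl[of 0 n 0] that by (simp add: Un_commute)
      have r2: "reflect {0..n} ` {0..n - j} = {j..n}" using refl[of "n - j" n 0] that by simp
      have r3: "reflect {0..n} ` {0..n} = {0..n}" using refl[of n n 0] by simp
      have "({0..j} \<union> {n}) \<inter> {j..n} = {j, n}" using that by auto
      then show ?thesis unfolding r1 r2 r3 restr_square_def by simp
    qed
    show ?thesis
    proof
      assume U: "right_2_Segal D X"
      show R.left
        unfolding R.left_def
      proof (intro allI impI)
        fix n j :: nat assume "3 \<le> n" "j \<le> n"
        then show "?R {0..n} ({0} \<union> {j..n}) {0..j}"
          using U *[of "n - j" n] unfolding right_2_Segal_def by simp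
      qed
    next
      assume L: R.left
      show "right_2_Segal D X"
        unfolding right_2_Segal_def
      proof (intro allI impI)
        fix n j :: nat assume n: "3 \<le> n" and j: "j \<le> n"
        have "?R {0..n} ({0} \<union> {n - j..n}) {0..n - j}"
          using L n unfolding R.left_def by (metis diff_le_self)
        then show "homotopy_cartesian D (restr X {0..n} ({0..j} \<union> {n})) (restr X {0..n} {j..n})
            (restr X ({0..j} \<union> {n}) {j, n}) (restr X {j..n} {j, n})"
          using *[OF j] by blast
      qed
    qed
  qed
  show ?thesis
    using S.lower_iff_left R.lower_iff_left S_lower S_left R_lower R_left by simp
qed

end
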